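(* Let $A$ be a finite set, let $\mu$ be a shift-ergodic Borel probability measure on $A^{\mathbb{Z}}$, and let $F\colon A^{\mathbb{Z}}\to A^{\mathbb{Z}}$ be a $\mu$-equicontinuous cellular automaton. Let $\mu_c=\lim_{n\to\infty}\frac{1}{n}\sum_{i=0}^{n-1}\mu\circ F^{-i}$ (vague limit, which exists under these hypotheses). Then $F$ is also a $\mu_c$-equicontinuous cellular automaton.
   Context: $A^{\mathbb{Z}}$ is the set of bi-infinite sequences $x=(x_i)_{i\in\mathbb{Z}}$ with $x_i\in A$, with the product topology of the discrete topologies on $A$. The shift $\sigma\colon A^{\mathbb{Z}}\to A^{\mathbb{Z}}$ is $\sigma(x)=(x_{i+1})_{i\in\mathbb{Z}}$. A cellular automaton is a continuous map $F\colon A^{\mathbb{Z}}\to A^{\mathbb{Z}}$ commuting with $\sigma$. Here $\mathbb{N}=\{0,1,2,\dots\}$. For integers $i\le j$, $x(i,j)$ denotes the word $x_i\ldots x_j$. For an integer $n\ge 0$ and $x\in A^{\mathbb{Z}}$, let $C_n(x)=\{y\in A^{\mathbb{Z}} : y_j=x_j \text{ for all } -n\le j\le n\}$ and $B_n(x)=\{y\in A^{\mathbb{Z}} : F^i(y)(-n,n)=F^i(x)(-n,n)\text{ for all } i\in\mathbb{N}\}$. For a Borel probability measure $\nu$ on $A^{\mathbb{Z}}$, a point $x$ is $\nu$-equicontinuous if for all $m\in\mathbb{N}$, $\lim_{n\to\infty}\frac{\nu(C_n(x)\cap B_m(x))}{\nu(C_n(x))}=1$ (in particular $\nu(C_n(x))>0$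 for all $n$, so that the quotients make sense). The cellular automaton $F$ is called $\nu$-equicontinuous if the set of $\nu$-equicontinuous points has full $\nu$-measure. $\mu$ is shift ergodic if it is $\sigma$-invariant and ergodic for $\sigma$; it is not assumed $F$-invariant. $\mu\circ F^{-i}$ is the image measure $E\mapsto\mu((F^{i})^{-1}(E))$. Vague convergence $\mu_n\to\mu_c$ means $\int f\,d\mu_n\to\int f\,d\mu_c$ for every continuous $f\colon A^{\mathbb{Z}}\to\mathbb{R}$. *)

theory Defs
  imports "HOL-Probability.Probability"
begin

text \<open>
  The alphabet is a type of sort \<open>{finite, discrete_topology}\<close>, so that the function type
  \<open>int \<Rightarrow> 'a\<close> carries the product of the discrete topologies
  (the topology instance for functions) and \<open>borel\<close> is its Borel \<open>\<sigma>\<close>-algebra.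
\<close>

type_synonym 'a config = "int \<Rightarrow> 'a"

definition shift :: "'a config \<Rightarrow> 'a config" where
  "shift x = (\<lambda>i. x (i + 1))"

definition cellular_automaton ::
    "('a::{finite, discrete_topology} config \<Rightarrow> 'a config) \<Rightarrow> bool" where
  "cellular_automaton F \<longleftrightarrow> continuous_on UNIV F \<and> F \<circ> shift = shift \<circ> F"

definition borel_prob :: "'b::topological_space measure \<Rightarrow> bool" where
  "borel_prob M \<longleftrightarrow> prob_space M \<and> sets M = sets borel"

definition shift_ergodic ::
    "'a::{finite, discrete_topology} config measure \<Rightarrow> bool" where
  "shift_ergodic \<mu> \<longleftrightarrow>
     distr \<mu> borel shift = \<mu> \<and>
     (\<forall>E\<in>sets \<mu>. shift -` E = E \<longrightarrow> measure \<mu> E = 0 \<or> measure \<mu> E = 1)"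

definition cyl :: "nat \<Rightarrow> 'a config \<Rightarrow> 'a config set" where
  "cyl n x = {y. \<forall>j. - int n \<le> j \<and> j \<le> int n \<longrightarrow> y j = x j}"

definition orbit_cyl ::
    "('a config \<Rightarrow> 'a config) \<Rightarrow> nat \<Rightarrow> 'a config \<Rightarrow> 'a config set" where
  "orbit_cyl F n x =
     {y. \<forall>i::nat. \<forall>j. - int n \<le> j \<and> j \<le> int n \<longrightarrow> (F ^^ i) y j = (F ^^ i) x j}"

definition equicontinuous_point ::
    "'a::{finite, discrete_topology} config measure \<Rightarrow> ('a config \<Rightarrow> 'a config) \<Rightarrow> 'a config \<Rightarrow> bool" where
  "equicontinuous_point \<nu> F x \<longleftrightarrow>
     (\<forall>n. measure \<nu> (cyl n x) > 0) \<and>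
     (\<forall>m. (\<lambda>n. measure \<nu> (cyl n x \<inter> orbit_cyl F m x) / measure \<nu> (cyl n x)) \<longlonglongrightarrow> 1)"

definition equicontinuous_CA ::
    "'a::{finite, discrete_topology} config measure \<Rightarrow> ('a config \<Rightarrow> 'a config) \<Rightarrow> bool" where
  "equicontinuous_CA \<nu> F \<longleftrightarrow>
     cellular_automaton F \<and> (AE x in \<nu>. equicontinuous_point \<nu> F x)"

definition cesaro_measure ::
    "'a::{finite, discrete_topology} config measure \<Rightarrow> ('a config \<Rightarrow> 'a config) \<Rightarrow> nat \<Rightarrow> 'a config measure" where
  "cesaro_measure \<mu> F n =
     measure_of UNIV (sets borel)
       (\<lambda>E. ennreal (1 / real n) * (\<Sum>i<n. emeasure (distr \<mu> borel (F ^^ i)) E))"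

text \<open>
  The configuration space is compact, so every continuous real function is an admissible
  test function.
\<close>

definition vague_limit ::
    "(nat \<Rightarrow> 'a::{finite, discrete_topology} config measure) \<Rightarrow> 'a config measure \<Rightarrow> bool" where
  "vague_limit M L \<longleftrightarrow>
     (\<forall>f :: 'a config \<Rightarrow> real. continuous_on UNIV f \<longrightarrow>
        (\<lambda>n. \<integral>x. f x \<partial>M n) \<longlonglongrightarrow> (\<integral>x. f x \<partial>L))"

text \<open>
  \<open>measure_of\<close> yields the null measure when the given set function is not a measure;
  the following lemma confirms that this does not happen here.
\<close>

lemma sets_cesaro_measure [simp]: "sets (cesaro_measure \<mu> F n) = sets borel"
  unfolding cesaro_measure_def
  by (metis sets.sigma_sets_eq sets_measure_of space_borel sets.space_closed)

lemma emeasure_cesaro_measure: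
  assumes "E \<in> sets borel"
  shows "emeasure (cesaro_measure \<mu> F n) E =
    ennreal (1 / real n) * (\<Sum>i<n. emeasure (distr \<mu> borel (F ^^ i)) E)"
proof (rule emeasure_measure_of[OF cesaro_measure_def])
  show "countably_additive (sets (cesaro_measure \<mu> F n))
     (\<lambda>E. ennreal (1 / real n) * (\<Sum>i<n. emeasure (distr \<mu> borel (F ^^ i)) E))"
    unfolding countably_additive_def
  proof (intro allI impI)
    fix A :: "nat \<Rightarrow> 'a config set"
    assume A: "range A \<subseteq> sets (cesaro_measure \<mu> F n)" and d: "disjoint_family A"
    have "(\<Sum>k. \<Sum>i<n. emeasure (distr \<mu> borel (F ^^ i)) (A k)) =
          (\<Sum>i<n. \<Sum>k. emeasure (distr \<mu> borel (F ^^ i)) (A k))"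
      by (rule suminf_sum) auto
    also have "\<dots> = (\<Sum>i<n. emeasure (distr \<mu> borel (F ^^ i)) (\<Union>(range A)))"
      using A d by (intro sum.cong refl suminf_emeasure) auto
    finally show "(\<Sum>k. ennreal (1 / real n) * (\<Sum>i<n. emeasure (distr \<mu> borel (F ^^ i)) (A k))) =
        ennreal (1 / real n) * (\<Sum>i<n. emeasure (distr \<mu> borel (F ^^ i)) (\<Union>(range A)))"
      by (simp add: ennreal_suminf_cmult)
  qed
qed (use assms in \<open>auto simp: positive_def\<close>)

end

theory Submission
  imports Defs
begin

text \<open>
  If \<open>x\<close> is \<open>\<mu>\<close>-equicontinuous, every orbit class \<open>orbit_cyl F m x\<close> has positive measure, so by
  Poincare recurrence for the shift some point \<open>y\<close> of the class has a translate in the same class.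
  For \<open>m\<close> at least the radius of \<open>F\<close>, the space-time strip of \<open>y\<close> between the two equal columns can be
  repeated periodically in space; a spatially periodic configuration has a finite orbit, hence the
  column of \<open>x\<close> is eventually periodic in time. Therefore the Cesaro averages of every clopen set
  converge, and the limits define a Borel measure.

  For any vague limit \<open>\<mu>c\<close>, the set of points whose column of width \<open>2 * m + 1\<close> is purely periodic is a
  countable union of closed sets and has full \<open>\<mu>c\<close>-measure. Such points fall into countably many orbit
  classes, each of which is a decreasing intersection of clopen sets, and the density theorem for cylinders
  applied to these classes gives \<open>\<mu>c\<close>-equicontinuity.
\<close>

section \<open>Cylinders\<close>

lemma mem_cyl: "y \<in> cyl n x \<longleftrightarrow> (\<forall>j. \<bar>j\<bar> \<le> int n \<longrightarrow> y j = x j)"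
  unfolding cyl_def by (auto simp: abs_le_iff minus_le_iff)

lemma cyl_refl [simp]: "x \<in> cyl n x"
  by (simp add: mem_cyl)

lemma cyl_eq: "y \<in> cyl n x \<Longrightarrow> cyl n y = cyl n x"
  by (auto simp: mem_cyl)

lemma cyl_antimono: "m \<le> n \<Longrightarrow> cyl n x \<subseteq> cyl m x"
  by (auto simp: mem_cyl)

lemma open_coord:
  fixes f :: "'b::topological_space \<Rightarrow> 'a::{finite, discrete_topology} config"
  assumes "continuous_on UNIV f"
  shows "open {y. f y j \<in> A}"
proof -
  have "continuous_on UNIV (\<lambda>y. f y j)"
    using assms by (rule continuous_on_product_then_coordinatewise)
  then have "open ((\<lambda>y. f y j) -` A)"
    by (intro open_vimage discrete_topology_class.open_discrete)
  then show ?thesis by (simp add: vimage_def)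
qed

text \<open>Leaving \<open>P\<close> arbitrary covers equality and inequality at once, so that
  conditions on finitely many coordinates come out both open and closed.\<close>

lemma open_coord_rel:
  fixes f g :: "'b::topological_space \<Rightarrow> 'a::{finite, discrete_topology} config"
  assumes "continuous_on UNIV f" "continuous_on UNIV g"
  shows "open {y. P (f y j) (g y j)}"
proof -
  have "{y. P (f y j) (g y j)} = (\<Union>a. {y. f y j \<in> {a}} \<inter> {y. g y j \<in> {b. P a b}})" by auto
  also have "open \<dots>" using assms by (intro open_UN ballI open_Int open_coord)
  finally show ?thesis .
qed

lemma finite_abs_le: "finite {j::int. \<bar>j\<bar> \<le> c}"
  by (rule finite_subset[of _ "{-c..c}"]) auto

lemma clopen_mem_cyl:
  fixes f g :: "'b::topological_space \<Rightarrow> 'a::{finite, discrete_topology} config"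
  assumes "continuous_on UNIV f" "continuous_on UNIV g"
  shows "open {y. f y \<in> cyl n (g y)}" "closed {y. f y \<in> cyl n (g y)}"
proof -
  have "{y. f y \<in> cyl n (g y)} = (\<Inter>j\<in>{j. \<bar>j\<bar> \<le> int n}. {y. f y j = g y j})"
    by (auto simp: mem_cyl)
  also have "open \<dots>" using assms by (intro open_INT finite_abs_le ballI open_coord_rel)
  finally show "open {y. f y \<in> cyl n (g y)}" .
  have "- {y. f y \<in> cyl n (g y)} = (\<Union>j\<in>{j. \<bar>j\<bar> \<le> int n}. {y. f y j \<noteq> g y j})"
    by (auto simp: mem_cyl)
  also have "open \<dots>" using assms by (intro open_UN ballI open_coord_rel)
  finally show "closed {y. f y \<in> cyl n (g y)}" by (simp add: closed_def)
qed

lemma open_cyl: "open (cyl n (x :: 'a::{finite, discrete_topology} config))"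
  using clopen_mem_cyl(1)[OF continuous_on_id continuous_on_const, of n x] by simp

lemma closed_cyl: "closed (cyl n (x :: 'a::{finite, discrete_topology} config))"
  using clopen_mem_cyl(2)[OF continuous_on_id continuous_on_const, of n x] by simp

lemma open_contains_cyl:
  fixes U :: "'a::{finite, discrete_topology} config set"
  assumes "open U" "x \<in> U"
  shows "\<exists>n. cyl n x \<subseteq> U"
proof -
  obtain X where X: "x \<in> Pi\<^sub>E UNIV X" "finite {i. X i \<noteq> UNIV}" "Pi\<^sub>E UNIV X \<subseteq> U"
    using product_topology_open_contains_basis[of "\<lambda>_. euclidean" UNIV U x] assms
    by (auto simp: open_fun_def)
  \<comment> \<open>A basic open set restricts only finitely many coordinates; \<open>n\<close>
    bounds their absolute values. The inserted 0 covers the case of no restricted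
    coordinate.\<close>
  define n where "n = nat (Max (insert 0 (abs ` {i. X i \<noteq> UNIV})))"
  have n: "\<bar>i\<bar> \<le> int n" if "X i \<noteq> UNIV" for i
    using X(2) that by (auto simp: n_def intro!: Max_ge)
  have "cyl n x \<subseteq> Pi\<^sub>E UNIV X"
  proof (intro subsetI)
    fix y assume y: "y \<in> cyl n x"
    have "y i \<in> X i" for i
    proof (cases "X i = UNIV")
      case False
      then have "y i = x i" using n y by (auto simp: mem_cyl)
      then show ?thesis using X(1) by auto
    qed simp
    then show "y \<in> Pi\<^sub>E UNIV X" by auto
  qed
  with X(3) show ?thesis by blast
qed

section \<open>Compactness of the configuration space and finite truncations\<close>

lemma compact_config: "compact (UNIV :: 'a::{finite, discrete_topology} config set)"
proof -
  have "compact_space (product_topology (\<lambda>_::int. euclidean :: 'a topology) UNIV)"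
    unfolding compact_space_product_topology
    by (simp add: compact_space_def finite_imp_compact)
  then show ?thesis by (simp add: euclidean_product_topology compact_space_def)
qed

text \<open>Cylinders behave like balls of an ultrametric: every point of a cylinder is a centre of
  it. Hence, once compactness leaves finitely many cylinders subordinate to the cover, the largest
  of their sizes works at every point.\<close>

lemma cyl_Lebesgue_number:
  fixes \<U> :: "'a::{finite, discrete_topology} config set set"
  assumes op: "\<And>U. U \<in> \<U> \<Longrightarrow> open U" and cov: "\<Union>\<U> = UNIV"
  shows "\<exists>n. \<forall>x. \<exists>U\<in>\<U>. cyl n x \<subseteq> U"
proof -
  have "\<exists>n. \<exists>U\<in>\<U>. cyl n x \<subseteq> U" for x
    using cov op open_contains_cyl[of _ x] by (metis UNIV_I UnionE)
  then obtain k where k: "\<And>x. \<exists>U\<in>\<U>. cyl (k x) x \<subseteq> U" by metis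
  obtain C where C: "finite C" "UNIV \<subseteq> (\<Union>x\<in>C. cyl (k x) x)"
  proof (rule compactE_image[OF compact_config, of UNIV "\<lambda>x. cyl (k x) x"])
    show "UNIV \<subseteq> (\<Union>x. cyl (k x) x)" using cyl_refl by blast
  qed (use open_cyl in auto)
  define n where "n = Max (insert 0 (k ` C))"
  show ?thesis
  proof (intro exI allI)
    fix x
    obtain z where z: "z \<in> C" "x \<in> cyl (k z) z" using C(2) by blast
    have "k z \<le> n" using C(1) z by (auto simp: n_def)
    then have "cyl n x \<subseteq> cyl (k z) z" using cyl_antimono cyl_eq[OF z(2)] by blast
    then show "\<exists>U\<in>\<U>. cyl n x \<subseteq> U" using k by (meson subset_trans)
  qed
qed

text \<open>Applied to the cover by \<open>E\<close> and its complement, the Lebesgue number says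
  that membership in \<open>E\<close> is decided by finitely many coordinates.\<close>

lemma clopen_cyl:
  fixes E :: "'a::{finite, discrete_topology} config set"
  assumes "open E" "closed E"
  obtains n where "\<And>x y. y \<in> cyl n x \<Longrightarrow> y \<in> E \<longleftrightarrow> x \<in> E"
proof -
  have "\<exists>n. \<forall>x. \<exists>U\<in>{E, - E}. cyl n x \<subseteq> U"
    using assms by (intro cyl_Lebesgue_number) auto
  then obtain n where n: "\<And>x. cyl n x \<subseteq> E \<or> cyl n x \<subseteq> - E" by auto
  show ?thesis
  proof (rule that)
    fix x y :: "'a config" assume "y \<in> cyl n x"
    then show "y \<in> E \<longleftrightarrow> x \<in> E" using n[of x] cyl_refl[of x n] by blast
  qed
qed

text \<open>A canonical representative of each cylinder of size \<open>n\<close>. The constant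
  filling outside the window makes the range finite, so that unions and sums over cylinders can be
  indexed by a finite set.\<close>

definition truncate :: "nat \<Rightarrow> 'a config \<Rightarrow> 'a config" where
  "truncate n x = (\<lambda>j. if \<bar>j\<bar> \<le> int n then x j else undefined)"

lemma truncate_in_cyl: "truncate n x \<in> cyl n x"
  by (simp add: truncate_def mem_cyl)

lemma truncate_eq_iff: "truncate n x = truncate n y \<longleftrightarrow> x \<in> cyl n y"
  by (auto simp: truncate_def mem_cyl fun_eq_iff)

lemma finite_range_truncate: "finite (range (truncate n :: 'a::finite config \<Rightarrow> 'a config))"
proof (rule finite_subset)
  show "range (truncate n :: 'a config \<Rightarrow> 'a config) \<subseteq> Pi\<^sub>E {j. \<bar>j\<bar> \<le> int n} (\<lambda>_. UNIV)"
    by (auto simp: truncate_def split: if_splits)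
  show "finite (Pi\<^sub>E {j. \<bar>j\<bar> \<le> int n} (\<lambda>_. UNIV :: 'a set))"
    by (intro finite_PiE finite_abs_le) auto
qed

lemma saturated_eq_UN_cyl:
  assumes "\<And>x y. y \<in> cyl n x \<Longrightarrow> x \<in> E \<Longrightarrow> y \<in> E"
  shows "E = (\<Union>u\<in>truncate n ` E. cyl n u)"
proof -
  have "cyl n (truncate n x) = cyl n x" for x :: "'a config"
    by (rule cyl_eq[OF truncate_in_cyl])
  then show ?thesis using assms by auto
qed

lemma open_eq_UN_cyl:
  fixes U :: "'a::{finite, discrete_topology} config set"
  assumes "open U"
  shows "U = (\<Union>n. \<Union>u\<in>{u\<in>range (truncate n). cyl n u \<subseteq> U}. cyl n u)" (is "_ = ?R")
proof
  show "U \<subseteq> ?R"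
  proof
    fix x assume "x \<in> U"
    then obtain n where n: "cyl n x \<subseteq> U" using open_contains_cyl assms by blast
    have "cyl n (truncate n x) = cyl n x" by (rule cyl_eq[OF truncate_in_cyl])
    then show "x \<in> ?R" using n cyl_refl[of x n] by blast
  qed
qed auto

text \<open>There are finitely many cylinders of each size, so every open set is a countable union
  of clopen sets. Unlike the open sets, the clopen sets form a ring, as the extension of contents
  requires.\<close>

lemma sets_borel_eq_clopen:
  "sets (borel :: 'a::{finite, discrete_topology} config measure) = sigma_sets UNIV {E. open E \<and> closed E}"
proof -
  have "sigma_sets UNIV {E::'a config set. open E} = sigma_sets UNIV {E. open E \<and> closed E}"
  proof (rule sigma_sets_eqI)
    fix U :: "'a config set" assume "U \<in> {E. open E}"
    then have U: "U = (\<Union>n. \<Union>u\<in>{u\<in>range (truncate n). cyl n u \<subseteq> U}. cyl n u)"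
      using open_eq_UN_cyl by blast
    interpret sigma_algebra UNIV "sigma_sets UNIV {E::'a config set. open E \<and> closed E}"
      by (rule sigma_algebra_sigma_sets) auto
    have "(\<Union>u\<in>{u\<in>range (truncate n). cyl n u \<subseteq> U}. cyl n u) \<in> sigma_sets UNIV {E. open E \<and> closed E}" for n
    proof (rule finite_UN)
      show "finite {u\<in>range (truncate n). cyl n u \<subseteq> U}"
        by (rule finite_subset[OF _ finite_range_truncate]) auto
    qed (use open_cyl closed_cyl in \<open>blast intro: sigma_sets.Basic\<close>)
    then have "(\<Union>n. \<Union>u\<in>{u\<in>range (truncate n). cyl n u \<subseteq> U}. cyl n u) \<in> sigma_sets UNIV {E. open E \<and> closed E}"
      by blast
    with U show "U \<in> sigma_sets UNIV {E. open E \<and> closed E}" by simp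
  qed auto
  then show ?thesis by (simp add: borel_def)
qed

section \<open>Eventually periodic columns\<close>

definition translate :: "int \<Rightarrow> 'a config \<Rightarrow> 'a config" where
  "translate k x = (\<lambda>i. x (i + k))"

lemma translate_apply: "translate k x i = x (i + k)"
  by (simp add: translate_def)

lemma shift_funpow: "(shift ^^ k) x = translate (int k) x"
  by (induction k) (auto simp: shift_def translate_def fun_eq_iff algebra_simps)

lemma CA_commutes_translate:
  assumes "cellular_automaton F"
  shows "F (translate k x) = translate k (F x)"
proof -
  have c: "F (shift x) = shift (F x)" for x
    using assms by (metis cellular_automaton_def comp_apply)
  have pos: "F (translate (int n) x) = translate (int n) (F x)" for n x
  proof (induction n)
    case (Suc n)
    have "translate (int (Suc n)) y = shift (translate (int n) y)" for y :: "'a config"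
      by (simp add: shift_def translate_def algebra_simps)
    then show ?case by (simp add: c Suc)
  qed (simp add: translate_def)
  show ?thesis
  proof (cases k)
    case (nonneg n) then show ?thesis using pos by simp
  next
    case (neg n)
    \<comment> \<open>A negative translation is undone by a positive one: the positive case is
      applied to \<open>translate k x\<close>, whose translate by \<open>Suc n\<close> is
      \<open>x\<close>.\<close>
    have "translate k (F (translate (int (Suc n)) (translate k x))) = translate k (translate (int (Suc n)) (F (translate k x)))"
      by (subst pos) simp
    then show ?thesis using neg by (simp add: translate_def)
  qed
qed

text \<open>One half of the Curtis-Hedlund-Lyndon theorem: the level sets of coordinate 0 of
  \<open>F\<close> form an open cover, whose Lebesgue number is the radius. Two independent
  positions \<open>j\<close> and \<open>j'\<close> are allowed, so that the rule can be transported
  along the period of a configuration.\<close>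

lemma CA_local_rule:
  fixes F :: "'a::{finite, discrete_topology} config \<Rightarrow> 'a config"
  assumes "cellular_automaton F"
  obtains r where "\<And>x y j j'. (\<And>l. \<bar>l\<bar> \<le> int r \<Longrightarrow> x (j + l) = y (j' + l)) \<Longrightarrow> F x j = F y j'"
proof -
  have "continuous_on UNIV F" using assms by (simp add: cellular_automaton_def)
  then have "\<exists>r. \<forall>x. \<exists>U\<in>range (\<lambda>a. {x. F x 0 = a}). cyl r x \<subseteq> U"
    by (intro cyl_Lebesgue_number) (auto intro: open_coord[where A = "{a}" for a, simplified])
  then obtain r where r: "\<And>x. \<exists>a. cyl r x \<subseteq> {x. F x 0 = a}" by auto
  show ?thesis
  proof
    fix x y :: "'a config" and j j' :: int
    assume e: "\<And>l. \<bar>l\<bar> \<le> int r \<Longrightarrow> x (j + l) = y (j' + l)"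
    obtain a where a: "cyl r (translate j x) \<subseteq> {x. F x 0 = a}" using r by blast
    have "translate j' y \<in> cyl r (translate j x)"
      using e by (simp add: mem_cyl translate_apply add.commute)
    then have "F (translate j' y) 0 = F (translate j x) 0" using a cyl_refl[of "translate j x" r] by blast
    then show "F x j = F y j'" by (simp add: CA_commutes_translate[OF assms] translate_apply)
  qed
qed

lemma CA_funpow:
  assumes "cellular_automaton F"
  shows "cellular_automaton (F ^^ i)"
proof (induction i)
  case 0 show ?case by (simp add: cellular_automaton_def fun_eq_iff)
next
  case (Suc i)
  have "continuous_on UNIV (F \<circ> F ^^ i)"
    using Suc assms by (intro continuous_on_compose) (auto simp: cellular_automaton_def intro: continuous_on_subset)
  moreover have "F \<circ> F ^^ i \<circ> shift = shift \<circ> (F \<circ> F ^^ i)"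
  proof -
    have "(F ^^ i) (shift x) = shift ((F ^^ i) x)" "F (shift x) = shift (F x)" for x
      using Suc assms by (metis cellular_automaton_def comp_apply)+
    then show ?thesis by (simp add: comp_def)
  qed
  ultimately show ?case by (simp add: cellular_automaton_def comp_def)
qed

text \<open>Only a single time \<open>i\<close> is tested, which keeps the condition clopen;
  periodicity is then an intersection of such conditions over the times.\<close>

definition columns_agree :: "('a config \<Rightarrow> 'a config) \<Rightarrow> nat \<Rightarrow> nat \<Rightarrow> nat \<Rightarrow> 'a config \<Rightarrow> bool" where
  "columns_agree F m p i x \<longleftrightarrow> (F ^^ (i + p)) x \<in> cyl m ((F ^^ i) x)"

definition eventually_periodic_column :: "('a config \<Rightarrow> 'a config) \<Rightarrow> nat \<Rightarrow> 'a config \<Rightarrow> bool" where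
  "eventually_periodic_column F m x \<longleftrightarrow> (\<exists>p>0. \<exists>N. \<forall>i\<ge>N. columns_agree F m p i x)"

text \<open>The strip between two columns of \<open>x\<close> with identical evolution, repeated periodically in
  space, is again an orbit of \<open>F\<close>.\<close>

lemma eventually_periodic_column_if_repeated:
  fixes F :: "'a::finite config \<Rightarrow> 'a config"
  assumes loc: "\<And>x y j j'. (\<And>l. \<bar>l\<bar> \<le> int r \<Longrightarrow> x (j + l) = y (j' + l)) \<Longrightarrow> F x j = F y j'"
    and rm: "r \<le> m" and k: "k > (0::nat)"
    and rep: "\<And>i j. \<bar>j\<bar> \<le> int m \<Longrightarrow> (F ^^ i) x (j + int k) = (F ^^ i) x j"
  shows "eventually_periodic_column F m x"
proof -
  \<comment> \<open>The \<open>k\<close> letters of the strip at time \<open>i\<close>, repeated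
    with spatial period \<open>k\<close>.\<close>
  define z where "z i = (\<lambda>j. (F ^^ i) x (j mod int k))" for i
  \<comment> \<open>To the right of the strip, \<open>rep\<close> moves a coordinate back by
    \<open>k\<close>. When \<open>m\<close> exceeds \<open>k\<close> one move may not reach the
    strip, hence the strong induction.\<close>
  have nonneg: "q < int k + int m \<Longrightarrow> (F ^^ i) x (int q) = z i (int q)" for i q
  proof (induction q rule: less_induct)
    case (less q)
    show ?case
    proof (cases "q < k")
      case True then show ?thesis by (simp add: z_def)
    next
      case False
      then have "(F ^^ i) x (int q) = (F ^^ i) x (int (q - k))"
        using rep[of "int (q - k)" i] less.prems by (simp add: of_nat_diff)
      also have "\<dots> = z i (int (q - k))" using False k less.prems by (intro less.IH) auto
      also have "\<dots> = z i (int q)" using False by (simp add: z_def of_nat_diff)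
      finally show ?thesis .
    qed
  qed
  have neg: "q \<le> m \<Longrightarrow> (F ^^ i) x (- int q) = z i (- int q)" for i q
  proof (induction q rule: less_induct)
    case (less q)
    show ?case
    proof (cases "q = 0")
      case True then show ?thesis using nonneg[of 0 i] k by simp
    next
      case q0: False
    have e: "(F ^^ i) x (- int q) = (F ^^ i) x (int k - int q)"
      using rep[of "- int q" i] less.prems by simp
    have "(F ^^ i) x (int k - int q) = z i (int k - int q)"
    proof (cases "q \<le> k")
      case True
      then show ?thesis using nonneg[of "k - q" i] q0 by (simp add: of_nat_diff)
    next
      case False
      then show ?thesis using less.IH[of "q - k"] k less.prems by (simp add: of_nat_diff)
    qed
    also have "\<dots> = z i (- int q)"
      using mod_add_self1[of "int k" "- int q"] by (simp add: z_def)
    finally show ?thesis using e by simp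
    qed
  qed
  \<comment> \<open>The true orbit agrees with its periodic model on the strip and on margins of
    width \<open>m\<close> at both sides. Since \<open>r\<close> is at most \<open>m\<close>, the
    margins contain everything the local rule reads when it updates the strip.\<close>
  have win: "(F ^^ i) x q = z i q" if "- int m \<le> q" "q < int k + int m" for i q
    using that nonneg[of "nat q" i] neg[of "nat (- q)" i] by (cases "q \<ge> 0") auto
  have step: "z (Suc i) = F (z i)" for i
  proof
    fix j
    define j0 where "j0 = j mod int k"
    have j0: "0 \<le> j0" "j0 < int k" using k by (auto simp: j0_def)
    have "F ((F ^^ i) x) j0 = F (z i) j"
    proof (rule loc)
      fix l :: int assume "\<bar>l\<bar> \<le> int r"
      then have "(F ^^ i) x (j0 + l) = z i (j0 + l)" using j0 rm by (intro win) auto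
      also have "\<dots> = z i (j + l)" by (simp add: z_def j0_def mod_add_left_eq)
      finally show "(F ^^ i) x (j0 + l) = z i (j + l)" .
    qed
    then show "z (Suc i) j = F (z i) j" by (simp add: z_def j0_def)
  qed
  have zF: "z (i + t) = (F ^^ t) (z i)" for i t
    by (induction t) (auto simp: step)
  \<comment> \<open>A configuration of spatial period \<open>k\<close> is determined by
    \<open>k\<close> letters, so the orbit of \<open>z 0\<close> visits finitely many states and two
    times must coincide.\<close>
  have "range z \<subseteq> (\<lambda>g j. g (j mod int k)) ` (Pi\<^sub>E {0..<int k} (\<lambda>_. UNIV))"
  proof
    fix y assume "y \<in> range z"
    then obtain i where y: "y = z i" by blast
    show "y \<in> (\<lambda>g j. g (j mod int k)) ` (Pi\<^sub>E {0..<int k} (\<lambda>_. UNIV))"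
      using k by (intro image_eqI[of _ _ "restrict (z i) {0..<int k}"]) (auto simp: y z_def fun_eq_iff)
  qed
  then have "finite (range z)"
    by (rule finite_subset) (intro finite_imageI finite_PiE; simp)
  then have "\<not> inj z" using finite_imageD infinite_UNIV_nat by blast
  then obtain a b where ab: "a < b" "z a = z b"
    by (metis injI linorder_neqE_nat)
  have per: "z (i + (b - a)) = z i" if "i \<ge> a" for i
  proof -
    have "z (i + (b - a)) = z (b + (i - a))" using that ab by (simp add: algebra_simps)
    also have "\<dots> = z (a + (i - a))" by (simp only: zF ab)
    finally show ?thesis using that by simp
  qed
  show ?thesis
    unfolding eventually_periodic_column_def columns_agree_def mem_cyl
  proof (intro exI conjI allI impI)
    show "0 < b - a" using ab by simp
    fix i j assume "a \<le> i" "\<bar>j\<bar> \<le> int m"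
    then show "(F ^^ (i + (b - a))) x j = (F ^^ i) x j"
      using per[of i] k by (simp add: win)
  qed
qed

text \<open>Poincare recurrence by pigeonhole: the iterated preimages of \<open>B\<close> all have
  the measure of \<open>B\<close>, so more than \<open>1 / measure M B\<close> of them cannot be
  pairwise disjoint. A common point of two of them yields the return.\<close>

lemma measure_preserving_recurrence:
  assumes "prob_space M" and T: "T \<in> measurable M M"
    and inv: "\<And>A. A \<in> sets M \<Longrightarrow> measure M (T -` A \<inter> space M) = measure M A"
    and B: "B \<in> sets M" "measure M B > 0"
  obtains k x where "k > 0" "x \<in> B" "(T ^^ k) x \<in> B"
proof -
  interpret prob_space M by fact
  define A where "A k = (T ^^ k) -` B \<inter> space M" for k
  have Tk: "T ^^ k \<in> measurable M M" for k
    using T by (rule measurable_compose_n)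
  have A_sets: "A k \<in> sets M" for k
    unfolding A_def using Tk B(1) by (rule measurable_sets)
  have A_meas: "measure M (A k) = measure M B" for k
  proof (induction k)
    case 0
    show ?case using sets.sets_into_space[OF B(1)] by (simp add: A_def Int_absorb2)
  next
    case (Suc k)
    have "A (Suc k) = T -` A k \<inter> space M"
      using measurable_space[OF T] by (auto simp: A_def funpow_swap1)
    then show ?case using inv[OF A_sets] Suc by simp
  qed
  obtain n :: nat where n: "1 / measure M B < real n" using reals_Archimedean2 by blast
  have "\<not> disjoint_family_on A {..<n}"
  proof
    assume "disjoint_family_on A {..<n}"
    then have "measure M (\<Union>k\<in>{..<n}. A k) = (\<Sum>k<n. measure M (A k))"
      using A_sets by (intro finite_measure_finite_Union) auto
    then have "real n * measure M B \<le> 1"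
      using prob_le_1[of "\<Union>k\<in>{..<n}. A k"] by (simp add: A_meas)
    then show False using n B(2) by (simp add: field_simps)
  qed
  then obtain i j x where ij: "i < j" "x \<in> A i" "x \<in> A j"
    unfolding disjoint_family_on_def by (metis disjoint_iff linorder_neqE_nat)
  have "(T ^^ j) x = (T ^^ (j - i)) ((T ^^ i) x)"
    using ij(1) by (simp flip: funpow_add comp_apply[of "T ^^ (j - i)" "T ^^ i"])
  then show ?thesis using that[of "j - i" "(T ^^ i) x"] ij by (simp add: A_def)
qed

lemma orbit_cyl_eq: "orbit_cyl F m x = {y. \<forall>i. (F ^^ i) y \<in> cyl m ((F ^^ i) x)}"
  unfolding orbit_cyl_def cyl_def by auto

lemma CA_funpow_continuous:
  "cellular_automaton F \<Longrightarrow> continuous_on UNIV (F ^^ i)"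
  using CA_funpow by (auto simp: cellular_automaton_def)

lemma CA_funpow_measurable:
  "cellular_automaton F \<Longrightarrow> sets M = sets borel \<Longrightarrow> F ^^ i \<in> measurable M borel"
  using borel_measurable_continuous_onI[OF CA_funpow_continuous]
  by (simp cong: measurable_cong_sets)

text \<open>The class is a countable intersection of clopen conditions, one for each time
  step.\<close>

lemma closed_orbit_cyl:
  assumes "cellular_automaton F"
  shows "closed (orbit_cyl F m x)"
proof -
  have "orbit_cyl F m x = (\<Inter>i. {y. (F ^^ i) y \<in> cyl m ((F ^^ i) x)})"
    by (auto simp: orbit_cyl_eq)
  also have "closed \<dots>"
    by (intro closed_INT ballI clopen_mem_cyl CA_funpow_continuous assms continuous_on_const)
  finally show ?thesis .
qed

lemma eventually_periodic_column_mono: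
  "eventually_periodic_column F n x \<Longrightarrow> m \<le> n \<Longrightarrow> eventually_periodic_column F m x"
  unfolding eventually_periodic_column_def columns_agree_def using cyl_antimono by blast

text \<open>Recurrence under the shift gives a point \<open>y\<close> of the class with a translate
  in the same class. The columns of \<open>y\<close> around 0 and around \<open>k\<close> then both
  evolve like the central column of \<open>x\<close>, and the strip argument applies to
  \<open>y\<close>.\<close>

lemma orbit_cyl_positive_imp_eventually_periodic:
  fixes \<mu> :: "'a::{finite, discrete_topology} config measure"
  assumes \<mu>: "borel_prob \<mu>" and inv: "distr \<mu> borel shift = \<mu>"
    and CA: "cellular_automaton F"
    and pos: "\<And>n. measure \<mu> (orbit_cyl F n x) > 0"
  shows "eventually_periodic_column F m x"
proof -
  interpret prob_space \<mu> using \<mu> by (simp add: borel_prob_def)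
  have sets[measurable_cong]: "sets \<mu> = sets borel" using \<mu> by (simp add: borel_prob_def)
  obtain r where r: "\<And>x y j j'. (\<And>l. \<bar>l\<bar> \<le> int r \<Longrightarrow> x (j + l) = y (j' + l)) \<Longrightarrow> F x j = F y j'"
    using CA_local_rule[OF CA] by metis
  \<comment> \<open>The column is widened to at least the radius, as the strip argument demands; the
    conclusion for \<open>m\<close> follows by monotonicity.\<close>
  define n where "n = max m r"
  have "continuous_on UNIV (shift :: 'a config \<Rightarrow> 'a config)"
    unfolding shift_def by (intro continuous_on_coordinatewise_then_product continuous_on_product_coordinates)
  then have sh: "shift \<in> measurable \<mu> \<mu>"
    unfolding measurable_cong_sets[OF sets sets] by (rule borel_measurable_continuous_onI)
  have inv': "measure \<mu> (shift -` A \<inter> space \<mu>) = measure \<mu> A" if "A \<in> events" for A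
  proof -
    have "shift \<in> measurable \<mu> borel" using sh by (simp add: measurable_cong_sets[OF refl sets])
    then have "measure (distr \<mu> borel shift) A = measure \<mu> (shift -` A \<inter> space \<mu>)"
      using that sets by (intro measure_distr) auto
    then show ?thesis by (simp add: inv)
  qed
  have "orbit_cyl F n x \<in> events"
    using closed_orbit_cyl[OF CA] by (simp add: sets)
  then obtain k y where ky: "k > 0" "y \<in> orbit_cyl F n x" "(shift ^^ k) y \<in> orbit_cyl F n x"
    using measure_preserving_recurrence[OF prob_space_axioms sh inv' _ pos] by metis
  have sh_eq: "(F ^^ i) ((shift ^^ k) y) = translate (int k) ((F ^^ i) y)" for i
    using CA_commutes_translate[OF CA_funpow[OF CA]] by (simp add: shift_funpow)
  have y_x: "(F ^^ i) y j = (F ^^ i) x j" "(F ^^ i) y (j + int k) = (F ^^ i) x j" if "\<bar>j\<bar> \<le> int n" for i j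
    using ky that by (auto simp: orbit_cyl_eq mem_cyl sh_eq translate_apply)
  have "eventually_periodic_column F n y"
    by (rule eventually_periodic_column_if_repeated[OF r _ ky(1)]) (auto simp: n_def y_x)
  then have "eventually_periodic_column F n x"
    by (simp add: eventually_periodic_column_def columns_agree_def mem_cyl y_x)
  then show ?thesis by (rule eventually_periodic_column_mono) (simp add: n_def)
qed

text \<open>A ratio tending to 1 is positive for some \<open>n\<close>, and its numerator bounds the
  measure of the class from below.\<close>

lemma equicontinuous_point_orbit_cyl_positive:
  assumes "prob_space \<nu>" "sets \<nu> = sets borel" "cellular_automaton F" "equicontinuous_point \<nu> F x"
  shows "measure \<nu> (orbit_cyl F m x) > 0"
proof -
  interpret prob_space \<nu> by fact
  have "(\<lambda>n. measure \<nu> (cyl n x \<inter> orbit_cyl F m x) / measure \<nu> (cyl n x)) \<longlonglongrightarrow> 1"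
    using assms(4) by (simp add: equicontinuous_point_def)
  then have "eventually (\<lambda>n. measure \<nu> (cyl n x \<inter> orbit_cyl F m x) / measure \<nu> (cyl n x) > 0) sequentially"
    by (rule order_tendstoD) simp
  then obtain n where "measure \<nu> (cyl n x \<inter> orbit_cyl F m x) / measure \<nu> (cyl n x) > 0"
    by (auto simp: eventually_sequentially)
  then have "0 < measure \<nu> (cyl n x \<inter> orbit_cyl F m x)"
    by (metis div_0 measure_nonneg order_less_irrefl order_le_less)
  also have "\<dots> \<le> measure \<nu> (orbit_cyl F m x)"
    using closed_orbit_cyl[OF assms(3)] by (intro finite_measure_mono) (auto simp: assms(2))
  finally show ?thesis .
qed

lemma AE_eventually_periodic_columns:
  fixes \<mu> :: "'a::{finite, discrete_topology} config measure"
  assumes \<mu>: "borel_prob \<mu>" and inv: "distr \<mu> borel shift = \<mu>" and eq: "equicontinuous_CA \<mu> F"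
  shows "AE x in \<mu>. \<forall>m. eventually_periodic_column F m x"
proof -
  have CA: "cellular_automaton F" and AE: "AE x in \<mu>. equicontinuous_point \<mu> F x"
    using eq by (auto simp: equicontinuous_CA_def)
  show ?thesis
    using AE
  proof eventually_elim
    case (elim x)
    then have "measure \<mu> (orbit_cyl F m x) > 0" for m
      using equicontinuous_point_orbit_cyl_positive CA \<mu> by (auto simp: borel_prob_def)
    then show ?case using orbit_cyl_positive_imp_eventually_periodic[OF \<mu> inv CA] by blast
  qed
qed

section \<open>Convergence of the Cesaro averages\<close>

lemma eventually_periodic_bounded:
  fixes d :: "nat \<Rightarrow> real"
  assumes p: "p > 0" and per: "\<And>n. n \<ge> N \<Longrightarrow> d (n + p) = d n"
  shows "\<exists>K. \<forall>n. \<bar>d n\<bar> \<le> K"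
proof -
  define K where "K = Max ((\<lambda>n. \<bar>d n\<bar>) ` {..<N + p})"
  have "\<bar>d n\<bar> \<le> K" for n
  proof (induction n rule: less_induct)
    case (less n)
    show ?case
    proof (cases "n < N + p")
      case True then show ?thesis by (auto simp: K_def intro!: Max_ge)
    next
      case False
      then have "d n = d (n - p)" using per[of "n - p"] by simp
      then show ?thesis using less.IH[of "n - p"] False p by simp
    qed
  qed
  then show ?thesis by blast
qed

lemma eventually_periodic_cesaro_convergent:
  fixes a :: "nat \<Rightarrow> real"
  assumes p: "p > 0" and per: "\<And>n. n \<ge> N \<Longrightarrow> a (n + p) = a n"
  shows "convergent (\<lambda>n. (\<Sum>i<n. a i) / real n)"
proof -
  define S where "S n = (\<Sum>i<n. a i)" for n
  \<comment> \<open>The mean over one period. Subtracting \<open>c * real n\<close> from the partial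
    sums leaves an eventually periodic, hence bounded, sequence, which vanishes after division by
    \<open>n\<close>.\<close>
  define c where "c = (S (N + p) - S N) / real p"
  have S_add: "S (n + p) - S n = c * real p" if "n \<ge> N" for n
    using that
  proof (induction n rule: dec_induct)
    case base then show ?case using p by (simp add: c_def)
  next
    case (step n)
    then show ?case using per[of n] by (simp add: S_def)
  qed
  obtain K where K: "\<And>n. \<bar>S n - c * real n\<bar> \<le> K"
    using eventually_periodic_bounded[OF p, of N "\<lambda>n. S n - c * real n"] S_add
    by (auto simp: algebra_simps)
  have "(\<lambda>n. S n / real n - c) \<longlonglongrightarrow> 0"
  proof (rule Lim_null_comparison)
    show "\<forall>\<^sub>F n in sequentially. norm (S n / real n - c) \<le> K / real n"
      using eventually_gt_at_top[of 0]
    proof eventually_elim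
      case (elim n)
      then have "S n / real n - c = (S n - c * real n) / real n" by (simp add: field_simps)
      then show ?case using K[of n] by (simp add: abs_divide divide_right_mono)
    qed
    show "(\<lambda>n. K / real n) \<longlonglongrightarrow> 0" by (rule lim_const_over_n)
  qed
  then have "(\<lambda>n. S n / real n) \<longlonglongrightarrow> c" by (simp add: LIM_zero_iff)
  then show ?thesis unfolding S_def by (rule convergentI)
qed

section \<open>Cesaro averages as probability measures\<close>

lemma measure_cesaro_measure:
  fixes \<mu> :: "'a::{finite, discrete_topology} config measure"
  assumes \<mu>: "borel_prob \<mu>" and CA: "cellular_automaton F" and E: "E \<in> sets borel"
  shows "measure (cesaro_measure \<mu> F n) E = (\<Sum>i<n. measure \<mu> ((F ^^ i) -` E)) / real n"
proof -
  interpret prob_space \<mu> using \<mu> by (simp add: borel_prob_def)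
  have sets: "sets \<mu> = sets borel" using \<mu> by (simp add: borel_prob_def)
  have sp: "space \<mu> = UNIV" using sets_eq_imp_space_eq[OF sets] by simp
  have "emeasure (distr \<mu> borel (F ^^ i)) E = ennreal (measure \<mu> ((F ^^ i) -` E))" for i
    using E by (simp add: emeasure_distr[OF CA_funpow_measurable[OF CA sets]] sp emeasure_eq_measure)
  \<comment> \<open>The case \<open>n = 0\<close> is included: the empty sum makes both sides 0. The
    average is a probability measure only for positive \<open>n\<close>.\<close>
  then have "emeasure (cesaro_measure \<mu> F n) E = ennreal ((\<Sum>i<n. measure \<mu> ((F ^^ i) -` E)) / real n)"
    by (simp add: emeasure_cesaro_measure[OF E] sum_nonneg divide_simps flip: ennreal_mult')
  then show ?thesis by (simp add: measure_def sum_nonneg)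
qed

lemma prob_space_cesaro_measure:
  fixes \<mu> :: "'a::{finite, discrete_topology} config measure"
  assumes \<mu>: "borel_prob \<mu>" and CA: "cellular_automaton F" and n: "n > 0"
  shows "prob_space (cesaro_measure \<mu> F n)"
proof
  interpret prob_space \<mu> using \<mu> by (simp add: borel_prob_def)
  have sets: "sets \<mu> = sets borel" using \<mu> by (simp add: borel_prob_def)
  have sp: "space \<mu> = UNIV" using sets_eq_imp_space_eq[OF sets] by simp
  have d: "emeasure (distr \<mu> borel (F ^^ i)) UNIV = 1" for i
    using emeasure_space_1 by (simp add: emeasure_distr[OF CA_funpow_measurable[OF CA sets]] sp)
  have "space (cesaro_measure \<mu> F n) = UNIV"
    using sets_eq_imp_space_eq[OF sets_cesaro_measure, of \<mu> F n] by simp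
  moreover have "ennreal (1 / real n) * of_nat n = 1"
    using n by (simp add: ennreal_of_nat_eq_real_of_nat flip: ennreal_mult')
  ultimately show "emeasure (cesaro_measure \<mu> F n) (space (cesaro_measure \<mu> F n)) = 1"
    by (simp add: emeasure_cesaro_measure d)
qed

text \<open>The averaged measure of \<open>E\<close> is the integral of the proportion
  \<open>u n x\<close> of times below \<open>n\<close> at which the orbit of \<open>x\<close> is in
  \<open>E\<close>. Membership in \<open>E\<close> depends on a finite window, so eventually
  periodic columns make these proportions converge almost everywhere; dominated convergence passes
  to the integrals.\<close>

lemma convergent_cesaro_measure_clopen:
  fixes \<mu> :: "'a::{finite, discrete_topology} config measure"
  assumes \<mu>: "borel_prob \<mu>" and CA: "cellular_automaton F"
    and AE: "AE x in \<mu>. \<forall>m. eventually_periodic_column F m x"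
    and E: "open E" "closed E"
  shows "convergent (\<lambda>n. measure (cesaro_measure \<mu> F n) E)"
proof -
  interpret prob_space \<mu> using \<mu> by (simp add: borel_prob_def)
  have sets: "sets \<mu> = sets borel" using \<mu> by (simp add: borel_prob_def)
  have sp: "space \<mu> = UNIV" using sets_eq_imp_space_eq[OF sets] by simp
  define u where "u n x = (\<Sum>i<n. indicator E ((F ^^ i) x)) / real n" for n x
  have u_meas: "u n \<in> borel_measurable \<mu>" for n
    unfolding u_def using E
    by (intro borel_measurable_divide borel_measurable_sum measurable_compose[OF CA_funpow_measurable[OF CA sets]])
      auto
  have bound: "\<bar>u n x\<bar> \<le> 1" for n x
  proof -
    have "(\<Sum>i<n. indicator E ((F ^^ i) x)) \<le> (\<Sum>i<n. 1 :: real)"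
      by (intro sum_mono) (simp add: indicator_def)
    then show ?thesis by (auto simp: u_def divide_simps sum_nonneg)
  qed
  obtain m where m: "\<And>x y. y \<in> cyl m x \<Longrightarrow> y \<in> E \<longleftrightarrow> x \<in> E" using clopen_cyl[OF E] by metis
  have lim: "AE x in \<mu>. (\<lambda>n. u n x) \<longlonglongrightarrow> lim (\<lambda>n. u n x)"
    using AE
  proof eventually_elim
    case (elim x)
    then obtain p N where p: "p > 0" and per: "\<And>i. i \<ge> N \<Longrightarrow> (F ^^ (i + p)) x \<in> cyl m ((F ^^ i) x)"
      unfolding eventually_periodic_column_def columns_agree_def by blast
    have "convergent (\<lambda>n. u n x)"
      unfolding u_def using m[OF per] p
      by (intro eventually_periodic_cesaro_convergent[of p N]) (auto simp: indicator_def)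
    then show ?case by (simp add: convergent_LIMSEQ_iff)
  qed
  have "(\<lambda>n. \<integral>x. u n x \<partial>\<mu>) \<longlonglongrightarrow> (\<integral>x. lim (\<lambda>n. u n x) \<partial>\<mu>)"
  proof (rule integral_dominated_convergence[where w = "\<lambda>_. 1"])
    show "(\<lambda>x. lim (\<lambda>n. u n x)) \<in> borel_measurable \<mu>"
      using u_meas by (rule borel_measurable_lim_metric)
  qed (use u_meas lim bound in auto)
  moreover have "(\<integral>x. u n x \<partial>\<mu>) = measure (cesaro_measure \<mu> F n) E" for n
  proof -
    have Fi: "(F ^^ i) -` E \<in> events" for i
      using measurable_sets[OF CA_funpow_measurable[OF CA sets], of E i] E by (simp add: sp)
    have ind: "indicator E ((F ^^ i) x) = (indicator ((F ^^ i) -` E) x :: real)" for i x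
      by (simp add: indicator_def)
    have "(\<integral>x. u n x \<partial>\<mu>) = (\<Sum>i<n. measure \<mu> ((F ^^ i) -` E)) / real n"
      unfolding u_def ind using Fi by (simp add: Bochner_Integration.integral_sum sp emeasure_eq_measure)
    then show ?thesis using measure_cesaro_measure[OF \<mu> CA] E by auto
  qed
  ultimately show ?thesis by (auto intro: convergentI)
qed

text \<open>Continuity at the empty set is automatic: by compactness a decreasing sequence of clopen
  sets with empty intersection is eventually empty.\<close>

lemma clopen_content_extends:
  fixes f :: "'a::{finite, discrete_topology} config set \<Rightarrow> real"
  assumes nonneg: "\<And>E. open E \<Longrightarrow> closed E \<Longrightarrow> 0 \<le> f E"
    and add: "\<And>D E. open D \<Longrightarrow> closed D \<Longrightarrow> open E \<Longrightarrow> closed E \<Longrightarrow> D \<inter> E = {} \<Longrightarrow> f (D \<union> E) = f D + f E"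
    and one: "f UNIV = 1"
  obtains M where "borel_prob M" "\<And>E. open E \<Longrightarrow> closed E \<Longrightarrow> measure M E = f E"
proof -
  define C where "C = {E::'a config set. open E \<and> closed E}"
  interpret ring_of_sets UNIV C
    by (rule ring_of_setsI) (auto simp: C_def intro: open_Diff closed_Diff)
  have f0: "f {} = 0"
  proof -
    have "f ({} \<union> {}) = f {} + f {}" by (rule add) auto
    then have "f {} = f {} + f {}" by (simp only: Un_empty_left)
    then show ?thesis by linarith
  qed
  have "\<exists>\<mu> :: 'a config set \<Rightarrow> ennreal. (\<forall>s \<in> C. \<mu> s = ennreal (f s)) \<and> measure_space UNIV (sigma_sets UNIV C) \<mu>"
  proof (rule caratheodory_empty_continuous)
    show "positive C (\<lambda>s. ennreal (f s))" by (simp add: positive_def f0)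
    show "additive C (\<lambda>s. ennreal (f s))"
      unfolding additive_def
    proof (intro ballI impI)
      fix D E assume "D \<in> C" "E \<in> C" "D \<inter> E = {}"
      then show "ennreal (f (D \<union> E)) = ennreal (f D) + ennreal (f E)"
        using add[of D E] nonneg[of D] nonneg[of E] by (simp add: C_def)
    qed
    fix A :: "nat \<Rightarrow> 'a config set"
    assume A: "range A \<subseteq> C" "decseq A" "(\<Inter>i. A i) = {}"
    have "\<exists>k. A k = {}"
    proof (rule ccontr)
      assume ne: "\<nexists>k. A k = {}"
      have "UNIV \<inter> (\<Inter>i\<in>UNIV. A i) \<noteq> {}"
      proof (rule compact_imp_fip_image[OF compact_config, rotated])
        fix I :: "nat set" assume I: "finite I" "I \<subseteq> UNIV"
        \<comment> \<open>In a decreasing sequence, a finite intersection contains the member of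
          largest index; the inserted 0 covers an empty \<open>I\<close>.\<close>
        have "A (Max (insert 0 I)) \<subseteq> A i" if "i \<in> I" for i
          by (rule decseqD[OF A(2)]) (use I(1) that in auto)
        then have "A (Max (insert 0 I)) \<subseteq> (\<Inter>i\<in>I. A i)" by blast
        then show "UNIV \<inter> (\<Inter>i\<in>I. A i) \<noteq> {}"
          using ne by auto
      qed (use A in \<open>auto simp: C_def\<close>)
      then show False using A(3) by simp
    qed
    then obtain k where "A k = {}" by blast
    then have "\<forall>i\<ge>k. A i = {}" using A(2) by (auto simp: decseq_def)
    then have "\<forall>\<^sub>F i in sequentially. ennreal (f (A i)) = 0"
      by (auto simp: eventually_sequentially f0 intro!: exI[of _ k])
    then show "(\<lambda>i. ennreal (f (A i))) \<longlonglongrightarrow> 0" by (rule tendsto_eventually)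
  qed simp
  then obtain \<mu> :: "'a config set \<Rightarrow> ennreal" where
    \<mu>: "\<And>s. s \<in> C \<Longrightarrow> \<mu> s = ennreal (f s)" and ms: "measure_space UNIV (sigma_sets UNIV C) \<mu>" by blast
  define M where "M = measure_of UNIV (sigma_sets UNIV C) \<mu>"
  have sets: "sets M = sigma_sets UNIV C"
    by (simp add: M_def sigma_sets_sigma_sets_eq)
  have em: "emeasure M s = \<mu> s" if "s \<in> sigma_sets UNIV C" for s
    using ms that by (intro emeasure_measure_of[OF M_def]) (auto simp: measure_space_def sets)
  have emC: "emeasure M s = ennreal (f s)" if "s \<in> C" for s
    using em[of s] \<mu>[OF that] that by (simp add: sigma_sets.Basic)
  show ?thesis
  proof
    have "prob_space M"
      by (rule prob_spaceI) (simp add: M_def[THEN arg_cong[of _ _ space]] emC C_def one)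
    then show "borel_prob M"
      by (simp add: borel_prob_def sets sets_borel_eq_clopen C_def)
    show "measure M E = f E" if "open E" "closed E" for E
      using emC[of E] that nonneg[of E] by (simp add: measure_def C_def)
  qed
qed

section \<open>Vague convergence tested on cylinders\<close>

lemma cyl_uniform_continuity:
  fixes f :: "'a::{finite, discrete_topology} config \<Rightarrow> real"
  assumes f: "continuous_on UNIV f" and e: "e > 0"
  obtains m where "\<And>x y. y \<in> cyl m x \<Longrightarrow> \<bar>f y - f x\<bar> < e"
proof -
  \<comment> \<open>The cover consists of the preimages of the open intervals of length
    \<open>e\<close>: two points in one member have values less than \<open>e\<close> apart.\<close>
  have "\<exists>m. \<forall>x. \<exists>U\<in>range (\<lambda>c. f -` {c<..<c + e}). cyl m x \<subseteq> U"
  proof (rule cyl_Lebesgue_number)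
    show "\<Union>(range (\<lambda>c. f -` {c<..<c + e})) = UNIV"
    proof -
      have "x \<in> f -` {f x - e / 2<..<f x - e / 2 + e}" for x using e by (simp add: field_simps)
      then show ?thesis by blast
    qed
  qed (use f in \<open>auto intro!: open_vimage\<close>)
  then obtain m where m: "\<And>x. \<exists>c. cyl m x \<subseteq> f -` {c<..<c + e}" by blast
  show ?thesis
  proof
    fix x y :: "'a config" assume "y \<in> cyl m x"
    moreover obtain c where "cyl m x \<subseteq> f -` {c<..<c + e}" using m by blast
    ultimately have "f y \<in> {c<..<c + e}" "f x \<in> {c<..<c + e}" using cyl_refl[of x m] by blast+
    then show "\<bar>f y - f x\<bar> < e" by (auto simp: abs_less_iff)
  qed
qed

lemma integral_truncate:
  fixes f :: "'a::{finite, discrete_topology} config \<Rightarrow> real"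
  assumes M: "borel_prob M"
  shows "(\<integral>x. f (truncate m x) \<partial>M) = (\<Sum>u\<in>range (truncate m). f u * measure M (cyl m u))"
    and "integrable M (\<lambda>x. f (truncate m x))"
proof -
  interpret prob_space M using M by (simp add: borel_prob_def)
  have sets: "sets M = sets borel" using M by (simp add: borel_prob_def)
  have sp: "space M = UNIV" using sets_eq_imp_space_eq[OF sets] by simp
  have cyl: "cyl m u \<in> events" for u using closed_cyl[of m u] by (simp add: sets)
  \<comment> \<open>Each point lies in exactly one cylinder around a truncated configuration, so
    \<open>f\<close> after truncation is a finite combination of cylinder indicators.\<close>
  have eq: "f (truncate m x) = (\<Sum>u\<in>range (truncate m). f u * indicator (cyl m u) x)" for x
  proof -
    have "x \<in> cyl m u \<longleftrightarrow> u = truncate m x" if "u \<in> range (truncate m)" for u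
    proof -
      from that obtain y where y: "u = truncate m y" by blast
      have "cyl m u = cyl m y" unfolding y by (rule cyl_eq[OF truncate_in_cyl])
      then have "x \<in> cyl m u \<longleftrightarrow> x \<in> cyl m y" by simp
      also have "\<dots> \<longleftrightarrow> truncate m x = truncate m y" by (rule truncate_eq_iff[symmetric])
      finally show ?thesis using y by auto
    qed
    then have "(\<Sum>u\<in>range (truncate m). f u * indicator (cyl m u) x) =
        (\<Sum>u\<in>range (truncate m). if u = truncate m x then f u else 0)"
      by (intro sum.cong) (auto simp: indicator_def)
    then show ?thesis by (simp add: sum.delta[OF finite_range_truncate])
  qed
  have int: "integrable M (\<lambda>x. f u * indicator (cyl m u) x)" for u
    using cyl by (simp add: emeasure_eq_measure sp)
  show "(\<integral>x. f (truncate m x) \<partial>M) = (\<Sum>u\<in>range (truncate m). f u * measure M (cyl m u))"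
    unfolding eq using int by (simp add: Bochner_Integration.integral_sum sp)
  show "integrable M (\<lambda>x. f (truncate m x))"
    unfolding eq using int by simp
qed

text \<open>Uniform continuity replaces a test function by its composition with a truncation, with
  the same error for all the probability measures involved. What remains is a finite sum of cylinder
  measures.\<close>

lemma vague_limitI_cyl:
  fixes M :: "nat \<Rightarrow> 'a::{finite, discrete_topology} config measure"
  assumes L: "borel_prob L" and M: "\<And>n. n > 0 \<Longrightarrow> borel_prob (M n)"
    and conv: "\<And>m u. (\<lambda>n. measure (M n) (cyl m u)) \<longlonglongrightarrow> measure L (cyl m u)"
  shows "vague_limit M L"
  unfolding vague_limit_def
proof (intro allI impI)
  fix f :: "'a config \<Rightarrow> real" assume f: "continuous_on UNIV f"
  have "bounded (range f)"
    using compact_continuous_image[OF f compact_config] by (rule compact_imp_bounded)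
  then obtain K where K: "\<And>x. \<bar>f x\<bar> \<le> K" by (auto simp: bounded_iff)
  have approx: "\<bar>(\<integral>x. f x \<partial>N) - (\<integral>x. f (truncate m x) \<partial>N)\<bar> \<le> e"
    if N: "borel_prob N" and m: "\<And>x y. y \<in> cyl m x \<Longrightarrow> \<bar>f y - f x\<bar> < e" for N m e
  proof -
    interpret prob_space N using N by (simp add: borel_prob_def)
    have sets: "sets N = sets borel" using N by (simp add: borel_prob_def)
    have fm: "f \<in> borel_measurable N"
      using borel_measurable_continuous_onI[OF f] sets by (simp cong: measurable_cong_sets)
    have fi: "integrable N f"
      using fm K by (intro integrable_const_bound[where B = K]) auto
    have "\<bar>(\<integral>x. f x \<partial>N) - (\<integral>x. f (truncate m x) \<partial>N)\<bar> = \<bar>\<integral>x. f x - f (truncate m x) \<partial>N\<bar>"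
      using fi integral_truncate(2)[OF N] by (simp add: Bochner_Integration.integral_diff)
    also have "\<dots> \<le> (\<integral>x. \<bar>f x - f (truncate m x)\<bar> \<partial>N)" by (rule integral_abs_bound)
    also have "\<dots> \<le> (\<integral>x. e \<partial>N)"
      using fi integral_truncate(2)[OF N] m[OF truncate_in_cyl]
      by (intro integral_mono) (auto simp: abs_minus_commute less_imp_le)
    finally show ?thesis by (simp add: prob_space)
  qed
  show "(\<lambda>n. \<integral>x. f x \<partial>M n) \<longlonglongrightarrow> (\<integral>x. f x \<partial>L)"
  proof (rule LIMSEQ_I)
    fix e :: real assume "e > 0"
    then have e3: "e / 3 > 0" by simp
    obtain m where m: "\<And>x y. y \<in> cyl m x \<Longrightarrow> \<bar>f y - f x\<bar> < e / 3"
      using cyl_uniform_continuity[OF f e3] by metis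
    have "(\<lambda>n. \<Sum>u\<in>range (truncate m). f u * measure (M n) (cyl m u)) \<longlonglongrightarrow>
        (\<Sum>u\<in>range (truncate m). f u * measure L (cyl m u))"
      by (intro tendsto_sum tendsto_mult tendsto_const conv)
    from LIMSEQ_D[OF this e3] obtain n0 where n0: "\<And>n. n \<ge> n0 \<Longrightarrow>
        \<bar>(\<Sum>u\<in>range (truncate m). f u * measure (M n) (cyl m u)) -
         (\<Sum>u\<in>range (truncate m). f u * measure L (cyl m u))\<bar> < e / 3"
      by auto
    \<comment> \<open>Starting from \<open>Suc n0\<close> excludes \<open>n = 0\<close>, where
      \<open>M n\<close> need not be a probability measure.\<close>
    have "norm ((\<integral>x. f x \<partial>M n) - (\<integral>x. f x \<partial>L)) < e" if "n \<ge> Suc n0" for n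
    proof -
      have Mn: "borel_prob (M n)" using M that by simp
      have "\<bar>(\<integral>x. f x \<partial>M n) - (\<Sum>u\<in>range (truncate m). f u * measure (M n) (cyl m u))\<bar> \<le> e / 3"
        using approx[OF Mn, of m "e / 3"] m by (simp add: integral_truncate(1)[OF Mn])
      moreover have "\<bar>(\<integral>x. f x \<partial>L) - (\<Sum>u\<in>range (truncate m). f u * measure L (cyl m u))\<bar> \<le> e / 3"
        using approx[OF L, of m "e / 3"] m by (simp add: integral_truncate(1)[OF L])
      ultimately show ?thesis
        using n0[of n] that unfolding real_norm_def by linarith
    qed
    then show "\<exists>no. \<forall>n\<ge>no. norm ((\<integral>x. f x \<partial>M n) - (\<integral>x. f x \<partial>L)) < e" by blast
  qed
qed

text \<open>The limits on clopen sets inherit finite additivity and total mass 1, so they extend to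
  a Borel probability measure. Convergence on cylinders then gives vague convergence.\<close>

lemma cesaro_vague_limit_exists:
  fixes \<mu> :: "'a::{finite, discrete_topology} config measure"
  assumes \<mu>: "borel_prob \<mu>" and CA: "cellular_automaton F"
    and AE: "AE x in \<mu>. \<forall>m. eventually_periodic_column F m x"
  shows "\<exists>\<mu>c. borel_prob \<mu>c \<and> vague_limit (cesaro_measure \<mu> F) \<mu>c"
proof -
  define M where "M = cesaro_measure \<mu> F"
  have M: "borel_prob (M n)" if "n > 0" for n
    using prob_space_cesaro_measure[OF \<mu> CA that] by (simp add: M_def borel_prob_def)
  define f where "f E = lim (\<lambda>n. measure (M n) E)" for E
  have f: "(\<lambda>n. measure (M n) E) \<longlonglongrightarrow> f E" if "open E" "closed E" for E
    using convergent_cesaro_measure_clopen[OF \<mu> CA AE that]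
    by (simp add: M_def f_def convergent_LIMSEQ_iff)
  obtain L where L: "borel_prob L" "\<And>E. open E \<Longrightarrow> closed E \<Longrightarrow> measure L E = f E"
  proof (rule clopen_content_extends[of f])
    show "0 \<le> f E" if "open E" "closed E" for E
      using f[OF that] by (rule LIMSEQ_le_const) auto
    show "f (D \<union> E) = f D + f E"
      if DE: "open D" "closed D" "open E" "closed E" "D \<inter> E = {}" for D E
    proof -
      have "measure (M n) D + measure (M n) E = measure (M n) (D \<union> E)" if "n \<ge> 1" for n
      proof -
        interpret prob_space "M n" using M[of n] that by (simp add: borel_prob_def)
        show ?thesis using DE by (intro finite_measure_Union[symmetric]) (auto simp: M_def)
      qed
      then have "(\<lambda>n. measure (M n) D + measure (M n) E) \<longlonglongrightarrow> f (D \<union> E)"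
        using DE by (intro Lim_transform_eventually[OF f[of "D \<union> E"] eventually_sequentiallyI[of 1]]) auto
      moreover have "(\<lambda>n. measure (M n) D + measure (M n) E) \<longlonglongrightarrow> f D + f E"
        using DE by (intro tendsto_add f)
      ultimately show ?thesis by (rule LIMSEQ_unique)
    qed
    have "measure (M n) UNIV = 1" if "n \<ge> 1" for n
    proof -
      interpret prob_space "M n" using M[of n] that by (simp add: borel_prob_def)
      show ?thesis using prob_space sets_eq_imp_space_eq[OF sets_cesaro_measure, of \<mu> F n] by (simp add: M_def)
    qed
    then have "(\<lambda>n. measure (M n) UNIV) \<longlonglongrightarrow> 1"
      by (intro tendsto_eventually) (auto simp: eventually_sequentially)
    then show "f UNIV = 1" using LIMSEQ_unique[OF f[of UNIV]] by simp
  qed metis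
  then have "vague_limit M L"
    using vague_limitI_cyl[OF L(1) M] f[OF open_cyl closed_cyl] L(2)[OF open_cyl closed_cyl] by simp
  then show ?thesis using L(1) unfolding M_def by blast
qed

section \<open>Density along cylinders\<close>

text \<open>For each \<open>x\<close> take the first \<open>n\<close> at which the inequality holds; the resulting cylinders are
  pairwise disjoint because cylinders are nested or disjoint.\<close>

lemma cyl_maximal_inequality:
  fixes \<nu> :: "'a::{finite, discrete_topology} config measure" and \<delta> :: real
  assumes \<nu>: "borel_prob \<nu>" and G: "G \<in> sets borel"
  defines "H \<equiv> {x. \<exists>n. \<delta> * measure \<nu> (cyl n x) \<le> measure \<nu> (cyl n x \<inter> G)}"
  shows "\<delta> * measure \<nu> H \<le> measure \<nu> G" and "H \<in> sets borel"
proof -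
  interpret prob_space \<nu> using \<nu> by (simp add: borel_prob_def)
  have sets: "sets \<nu> = sets borel" using \<nu> by (simp add: borel_prob_def)
  have cyl_sets: "cyl n x \<in> events" for n x using closed_cyl[of n x] by (simp add: sets)
  define P where "P n x \<longleftrightarrow> \<delta> * measure \<nu> (cyl n x) \<le> measure \<nu> (cyl n x \<inter> G)" for n x
  define V where "V n = {x. P n x \<and> (\<forall>k<n. \<not> P k x)}" for n
  have P_cong: "P k y \<longleftrightarrow> P k x" if "y \<in> cyl n x" "k \<le> n" for k n x y
    using cyl_eq[of y k x] cyl_antimono[of k n x] that by (auto simp: P_def)
  \<comment> \<open>Membership in \<open>V n\<close> consults only cylinders of size at most
    \<open>n\<close>, so \<open>V n\<close> is a finite union of cylinders of size \<open>n\<close>.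
    This gives its measurability and reduces the inequality to single cylinders.\<close>
  have V_eq: "V n = (\<Union>u\<in>truncate n ` V n. cyl n u)" for n
    by (rule saturated_eq_UN_cyl) (use P_cong in \<open>force simp: V_def\<close>)
  have fin: "finite (truncate n ` V n)" for n
    by (rule finite_subset[OF _ finite_range_truncate]) auto
  have V_sets: "V n \<in> events" for n
    by (subst V_eq) (intro sets.finite_UN fin cyl_sets)
  have disj: "disjoint_family_on (cyl n) (truncate n ` V n)" for n
  proof -
    have "truncate n x = truncate n y" if "z \<in> cyl n (truncate n x)" "z \<in> cyl n (truncate n y)" for x y z :: "'a config"
      using that truncate_eq_iff cyl_eq[OF truncate_in_cyl] by metis
    then show ?thesis by (auto simp: disjoint_family_on_def)
  qed
  have V_le: "\<delta> * measure \<nu> (V n) \<le> measure \<nu> (V n \<inter> G)" for n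
  proof -
    have "measure \<nu> (V n) = (\<Sum>u\<in>truncate n ` V n. measure \<nu> (cyl n u))"
      by (subst V_eq) (use fin cyl_sets disj in \<open>intro finite_measure_finite_Union, auto\<close>)
    then have "\<delta> * measure \<nu> (V n) = (\<Sum>u\<in>truncate n ` V n. \<delta> * measure \<nu> (cyl n u))"
      by (simp add: sum_distrib_left)
    also have "\<dots> \<le> (\<Sum>u\<in>truncate n ` V n. measure \<nu> (cyl n u \<inter> G))"
    proof (rule sum_mono)
      fix u assume "u \<in> truncate n ` V n"
      then obtain x where "x \<in> V n" "u = truncate n x" by blast
      then show "\<delta> * measure \<nu> (cyl n u) \<le> measure \<nu> (cyl n u \<inter> G)"
        by (simp add: V_def P_def cyl_eq[OF truncate_in_cyl])
    qed
    also have "\<dots> = measure \<nu> (\<Union>u\<in>truncate n ` V n. cyl n u \<inter> G)"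
    proof (rule finite_measure_finite_Union[symmetric])
      show "disjoint_family_on (\<lambda>u. cyl n u \<inter> G) (truncate n ` V n)"
        using disj[of n] unfolding disjoint_family_on_def by blast
    qed (use fin cyl_sets G sets in auto)
    also have "(\<Union>u\<in>truncate n ` V n. cyl n u \<inter> G) = V n \<inter> G"
      by (subst (2) V_eq) blast
    finally show ?thesis .
  qed
  have H_eq: "H = (\<Union>n. V n)"
  proof
    show "H \<subseteq> (\<Union>n. V n)"
    proof
      fix x assume "x \<in> H"
      then have "\<exists>n. P n x" by (auto simp: H_def P_def)
      then have "P (LEAST n. P n x) x" by (rule LeastI_ex)
      then have "x \<in> V (LEAST n. P n x)"
        by (auto simp: V_def dest: not_less_Least)
      then show "x \<in> (\<Union>n. V n)" by blast
    qed
  qed (auto simp: H_def V_def P_def)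
  have dV: "disjoint_family V"
    unfolding disjoint_family_on_def
  proof (intro ballI impI)
    fix i j :: nat assume "i \<noteq> j"
    then consider "i < j" | "j < i" by linarith
    then show "V i \<inter> V j = {}" by cases (auto simp: V_def)
  qed
  show "H \<in> sets borel" unfolding sets[symmetric] H_eq using V_sets by blast
  have "(\<lambda>n. \<delta> * measure \<nu> (V n)) sums (\<delta> * measure \<nu> H)"
    unfolding H_eq using V_sets dV by (intro sums_mult finite_measure_UNION) auto
  moreover have "(\<lambda>n. measure \<nu> (V n \<inter> G)) sums measure \<nu> (\<Union>n. V n \<inter> G)"
    using V_sets dV G by (intro finite_measure_UNION) (auto simp: disjoint_family_on_def sets)
  ultimately have "\<delta> * measure \<nu> H \<le> measure \<nu> (\<Union>n. V n \<inter> G)"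
    by (rule sums_le[OF V_le])
  also have "\<dots> \<le> measure \<nu> G"
    using G by (intro finite_measure_mono) (auto simp: sets)
  finally show "\<delta> * measure \<nu> H \<le> measure \<nu> G" .
qed

text \<open>A Lebesgue density theorem for decreasing intersections of open sets, with cylinders in
  place of balls. Orbit classes have this form.\<close>

lemma AE_cyl_density:
  fixes \<nu> :: "'a::{finite, discrete_topology} config measure"
  assumes \<nu>: "borel_prob \<nu>" and op: "\<And>k. open (E k)" and dec: "decseq E"
  defines "B \<equiv> \<Inter>k. E k"
  shows "AE x in \<nu>. x \<in> B \<longrightarrow> (\<forall>n. measure \<nu> (cyl n x) > 0) \<longrightarrow>
    (\<lambda>n. measure \<nu> (cyl n x \<inter> B) / measure \<nu> (cyl n x)) \<longlonglongrightarrow> 1"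
proof -
  interpret prob_space \<nu> using \<nu> by (simp add: borel_prob_def)
  have sets: "sets \<nu> = sets borel" using \<nu> by (simp add: borel_prob_def)
  have cyl_sets: "cyl n x \<in> events" for n x using closed_cyl[of n x] by (simp add: sets)
  have E_sets: "E k \<in> events" for k using op by (simp add: sets)
  then have B_sets: "B \<in> events" unfolding B_def by blast
  text \<open>Since \<open>x \<in> B\<close> has a cylinder inside each \<open>E k\<close>, it suffices to control \<open>E k - B\<close>, whose
    measure tends to \<open>0\<close>.\<close>
  define D where "D k \<delta> = {x. \<exists>n. \<delta> * measure \<nu> (cyl n x) \<le> measure \<nu> (cyl n x \<inter> (E k - B))}" for k and \<delta> :: real
  have G_sets: "E k - B \<in> sets borel" for k using E_sets B_sets sets by auto
  have "(\<lambda>k. measure \<nu> (E k)) \<longlonglongrightarrow> measure \<nu> B"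
    unfolding B_def using E_sets dec by (intro finite_Lim_measure_decseq) auto
  moreover have "measure \<nu> (E k - B) = measure \<nu> (E k) - measure \<nu> B" for k
    using E_sets B_sets by (intro finite_measure_Diff) (auto simp: B_def)
  ultimately have G_lim: "(\<lambda>k. measure \<nu> (E k - B)) \<longlonglongrightarrow> 0"
    by (simp add: LIM_zero)
  \<comment> \<open>The maximal inequality bounds \<open>\<delta>\<close> times the measure of
    \<open>D k \<delta>\<close> by that of \<open>E k - B\<close>, which tends to 0; points in all
    the \<open>D k \<delta>\<close> therefore form a null set.\<close>
  have null: "(\<Inter>k. D k \<delta>) \<in> null_sets \<nu>" if "\<delta> > 0" for \<delta>
  proof -
    have D_sets: "D k \<delta> \<in> events" for k
      unfolding D_def sets by (rule cyl_maximal_inequality(2)[OF \<nu> G_sets])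
    then have N_sets: "(\<Inter>k. D k \<delta>) \<in> events" by blast
    have "\<delta> * measure \<nu> (\<Inter>k. D k \<delta>) \<le> measure \<nu> (E k - B)" for k
    proof -
      have "\<delta> * measure \<nu> (\<Inter>k. D k \<delta>) \<le> \<delta> * measure \<nu> (D k \<delta>)"
        using that D_sets by (intro mult_left_mono finite_measure_mono) auto
      also have "\<dots> \<le> measure \<nu> (E k - B)"
        unfolding D_def by (rule cyl_maximal_inequality(1)[OF \<nu> G_sets])
      finally show ?thesis .
    qed
    then have "\<delta> * measure \<nu> (\<Inter>k. D k \<delta>) \<le> 0"
      by (intro LIMSEQ_le_const[OF G_lim]) blast
    then have "measure \<nu> (\<Inter>k. D k \<delta>) = 0"
      using that by (simp add: mult_le_0_iff measure_le_0_iff)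
    then show ?thesis using N_sets by (auto simp: null_sets_def emeasure_eq_measure)
  qed
  have "AE x in \<nu>. \<forall>j. x \<notin> (\<Inter>k. D k (1 / real (Suc j)))"
    unfolding AE_all_countable by (intro allI AE_not_in null) simp
  then show ?thesis
  proof eventually_elim
    case (elim x)
    show ?case
    proof (intro impI LIMSEQ_I)
      fix e :: real
      assume xB: "x \<in> B" and pos: "\<forall>n. measure \<nu> (cyl n x) > 0" and "e > 0"
      then obtain j where j: "1 / real (Suc j) < e" using nat_approx_posE by metis
      obtain k where k: "x \<notin> D k (1 / real (Suc j))" using elim by blast
      obtain n0 where n0: "cyl n0 x \<subseteq> E k"
        using open_contains_cyl[OF op, of x k] xB by (auto simp: B_def)
      \<comment> \<open>Beyond \<open>n0\<close> the cylinder splits into its parts in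
        \<open>B\<close> and in \<open>E k - B\<close>; the latter has proportion less than
        \<open>1 / real (Suc j)\<close> because \<open>x\<close> avoids \<open>D k\<close>.\<close>
      have "norm (measure \<nu> (cyl n x \<inter> B) / measure \<nu> (cyl n x) - 1) < e" if "n \<ge> n0" for n
      proof -
        have "cyl n x \<subseteq> E k" using n0 cyl_antimono[OF that] by blast
        then have "measure \<nu> (cyl n x) = measure \<nu> (cyl n x \<inter> B) + measure \<nu> (cyl n x \<inter> (E k - B))"
          using cyl_sets B_sets E_sets
          by (subst finite_measure_Union[symmetric]) (auto intro!: arg_cong[where f = "measure \<nu>"])
        moreover have "measure \<nu> (cyl n x \<inter> (E k - B)) < 1 / real (Suc j) * measure \<nu> (cyl n x)"
          using k by (auto simp: D_def not_le)
        ultimately have "norm (measure \<nu> (cyl n x \<inter> B) / measure \<nu> (cyl n x) - 1) < 1 / real (Suc j)"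
          using pos[rule_format, of n] measure_nonneg[of \<nu> "cyl n x \<inter> (E k - B)"]
          by (simp add: abs_less_iff field_simps)
        then show ?thesis using j by simp
      qed
      then show "\<exists>no. \<forall>n\<ge>no. norm (measure \<nu> (cyl n x \<inter> B) / measure \<nu> (cyl n x) - 1) < e" by blast
    qed
  qed
qed

text \<open>For each \<open>n\<close> the exceptional points are covered by the null cylinders of
  size \<open>n\<close>, of which there are finitely many.\<close>

lemma AE_cyl_positive:
  fixes \<nu> :: "'a::{finite, discrete_topology} config measure"
  assumes \<nu>: "borel_prob \<nu>"
  shows "AE x in \<nu>. \<forall>n. measure \<nu> (cyl n x) > 0"
  unfolding AE_all_countable
proof
  fix n
  interpret prob_space \<nu> using \<nu> by (simp add: borel_prob_def)
  have sets: "sets \<nu> = sets borel" using \<nu> by (simp add: borel_prob_def)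
  have "(\<Union>u\<in>{u\<in>range (truncate n). measure \<nu> (cyl n u) = 0}. cyl n u) \<in> null_sets \<nu>"
  proof (rule null_sets_UN')
    show "countable {u\<in>range (truncate n :: 'a config \<Rightarrow> _). measure \<nu> (cyl n u) = 0}"
      by (rule countable_subset[OF _ countable_finite[OF finite_range_truncate]]) auto
  qed (auto simp: null_sets_def emeasure_eq_measure sets intro: borel_closed closed_cyl)
  then show "AE x in \<nu>. measure \<nu> (cyl n x) > 0"
  proof (rule AE_I', intro subsetI)
    fix x assume "x \<in> {x \<in> space \<nu>. \<not> measure \<nu> (cyl n x) > 0}"
    then have "measure \<nu> (cyl n x) = 0" by (simp add: not_less measure_le_0_iff)
    moreover have "cyl n (truncate n x) = cyl n x" by (rule cyl_eq[OF truncate_in_cyl])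
    ultimately show "x \<in> (\<Union>u\<in>{u\<in>range (truncate n). measure \<nu> (cyl n u) = 0}. cyl n u)"
      using cyl_refl[of x n] by (intro UN_I[of "truncate n x"]) auto
  qed
qed

section \<open>Periodic columns under a vague limit\<close>

text \<open>As an equation between truncations, agreement becomes transitive by rewriting.\<close>

lemma columns_agree_iff:
  "columns_agree F m p i x \<longleftrightarrow> truncate m ((F ^^ (i + p)) x) = truncate m ((F ^^ i) x)"
  by (simp add: columns_agree_def truncate_eq_iff)

lemma columns_agree_mult:
  assumes "\<And>i. i \<ge> N \<Longrightarrow> columns_agree F m p i x" "i \<ge> N"
  shows "columns_agree F m (q * p) i x"
proof (induction q)
  case (Suc q)
  have "columns_agree F m p (i + q * p) x" using assms by simp
  moreover have "i + q * p + p = i + Suc q * p" by simp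
  ultimately show ?case using Suc by (simp only: columns_agree_iff)
qed (simp add: columns_agree_iff)

lemma columns_agree_funpow:
  "columns_agree F m p i ((F ^^ k) x) = columns_agree F m p (i + k) x"
proof -
  have "(F ^^ a) ((F ^^ k) x) = (F ^^ (a + k)) x" for a
    by (simp add: funpow_add)
  moreover have "i + p + k = i + k + p" by simp
  ultimately show ?thesis by (simp only: columns_agree_def)
qed

lemma clopen_columns_agree:
  fixes F :: "'a::{finite, discrete_topology} config \<Rightarrow> 'a config"
  assumes "cellular_automaton F"
  shows "open {x. columns_agree F m p i x}" "closed {x. columns_agree F m p i x}"
  unfolding columns_agree_def by (intro clopen_mem_cyl CA_funpow_continuous assms)+

lemma finite_factor_image:
  assumes "finite (h ` A)" "\<And>x y. x \<in> A \<Longrightarrow> y \<in> A \<Longrightarrow> h x = h y \<Longrightarrow> g x = g y"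
  shows "finite (g ` A)"
proof (rule finite_subset)
  show "g ` A \<subseteq> (\<lambda>v. g (inv_into A h v)) ` (h ` A)"
  proof
    fix y assume "y \<in> g ` A"
    then obtain x where x: "x \<in> A" "y = g x" by blast
    then have "g (inv_into A h (h x)) = y"
      using assms(2)[OF inv_into_into[of "h x" h A]] by (simp add: f_inv_into_f)
    then show "y \<in> (\<lambda>v. g (inv_into A h v)) ` (h ` A)" using x(1) by blast
  qed
qed (use assms(1) in simp)

text \<open>With period \<open>p\<close> fixed, the windows at times below \<open>p\<close>
  determine the whole column and thus the orbit class; there are finitely many choices for
  them.\<close>

lemma finite_periodic_orbit_cyls:
  fixes F :: "'a::finite config \<Rightarrow> 'a config"
  assumes p: "p > 0"
  shows "finite (orbit_cyl F m ` {x. \<forall>i. columns_agree F m p i x})"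
proof (rule finite_factor_image)
  let ?t = "\<lambda>x i. truncate m ((F ^^ i) x)"
  let ?P = "{x. \<forall>i. columns_agree F m p i x}"
  show "finite ((\<lambda>x. restrict (?t x) {..<p}) ` ?P)"
  proof (rule finite_subset)
    show "(\<lambda>x. restrict (?t x) {..<p}) ` ?P \<subseteq> (Pi\<^sub>E {..<p} (\<lambda>_. range (truncate m)))" by auto
    show "finite (Pi\<^sub>E {..<p} (\<lambda>_. range (truncate m :: 'a config \<Rightarrow> _)))"
      by (intro finite_PiE finite_range_truncate) auto
  qed
  have mod: "?t x i = ?t x (i mod p)" if "x \<in> ?P" for x i
  proof -
    have "columns_agree F m (i div p * p) (i mod p) x"
      using that by (intro columns_agree_mult[of 0]) auto
    then show ?thesis by (simp add: columns_agree_iff)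
  qed
  fix x y assume xy: "x \<in> ?P" "y \<in> ?P" and eq: "restrict (?t x) {..<p} = restrict (?t y) {..<p}"
  have "?t x i = ?t y i" for i
    using fun_cong[OF eq, of "i mod p"] mod[OF xy(1), of i] mod[OF xy(2), of i] p by simp
  then show "orbit_cyl F m x = orbit_cyl F m y"
    by (simp add: orbit_cyl_eq flip: truncate_eq_iff)
qed

lemma cesaro_lower_bound:
  fixes a :: "nat \<Rightarrow> real"
  assumes "\<And>i. 0 \<le> a i" "0 \<le> c" "\<And>i. i \<ge> I \<Longrightarrow> c \<le> a i"
    and lim: "(\<lambda>n. (\<Sum>i<n. a i) / real n) \<longlonglongrightarrow> L"
  shows "c \<le> L"
proof (rule LIMSEQ_le[OF _ lim])
  \<comment> \<open>The first \<open>I\<close> terms cost at most \<open>c * real I\<close>, which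
    disappears after division by \<open>n\<close>. For \<open>n < I\<close> the left side is at most
    0.\<close>
  have S: "c * real n - c * real I \<le> (\<Sum>i<n. a i)" for n
  proof (induction n)
    case 0 then show ?case using assms(2) by simp
  next
    case (Suc n)
    show ?case
    proof (cases "n \<ge> I")
      case True then show ?thesis using Suc assms(3)[of n] by (simp add: algebra_simps)
    next
      case False
      then have "c * real (Suc n) \<le> c * real I" using assms(2) by (intro mult_left_mono) auto
      moreover have "0 \<le> (\<Sum>i<Suc n. a i)" by (intro sum_nonneg assms(1))
      ultimately show ?thesis by linarith
    qed
  qed
  have "c - c * real I / real n \<le> (\<Sum>i<n. a i) / real n" if "n \<ge> 1" for n
    using divide_right_mono[OF S[of n], of "real n"] that by (simp add: diff_divide_distrib)
  then show "\<exists>N. \<forall>n\<ge>N. c - c * real I / real n \<le> (\<Sum>i<n. a i) / real n" by blast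
  show "(\<lambda>n. c - c * real I / real n) \<longlonglongrightarrow> c"
    using tendsto_diff[OF tendsto_const lim_const_over_n, of c "c * real I"] by simp
qed

section \<open>Transfer of periodicity to the limit measure\<close>

lemma vague_limit_clopen:
  fixes M :: "nat \<Rightarrow> 'a::{finite, discrete_topology} config measure"
  assumes lim: "vague_limit M L" and sets: "\<And>n. sets (M n) = sets borel" "sets L = sets borel"
    and E: "open E" "closed E"
  shows "(\<lambda>n. measure (M n) E) \<longlonglongrightarrow> measure L E"
proof -
  \<comment> \<open>The indicator of a clopen set is an admissible test function.\<close>
  have "continuous_on UNIV (indicator E :: 'a config \<Rightarrow> real)"
  proof -
    have "continuous_on (E \<union> - E) (\<lambda>x. if x \<in> E then 1 else 0 :: real)"
      using E by (intro continuous_on_cases) auto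
    moreover have "(\<lambda>x. if x \<in> E then 1 else 0 :: real) = indicator E" by auto
    ultimately show ?thesis by (simp only: Compl_partition)
  qed
  then have "(\<lambda>n. \<integral>x. indicator E x \<partial>M n) \<longlonglongrightarrow> (\<integral>x. indicator E x \<partial>L :: real)"
    using lim unfolding vague_limit_def by blast
  moreover have "space (M n) = UNIV" "space L = UNIV" for n
    using sets_eq_imp_space_eq[OF sets(1)] sets_eq_imp_space_eq[OF sets(2)] by auto
  ultimately show ?thesis by simp
qed

text \<open>From time \<open>I\<close> on, the automaton maps a point with column periodic from
  \<open>I\<close> to one with purely periodic column. Hence the image measures, and with them the
  limit of their averages, keep at least the mass of \<open>?Q\<close>.\<close>

lemma vague_limit_periodic_columns:
  fixes \<mu> :: "'a::{finite, discrete_topology} config measure"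
  assumes \<mu>: "borel_prob \<mu>" and CA: "cellular_automaton F"
    and L: "borel_prob L" and lim: "vague_limit (cesaro_measure \<mu> F) L"
  shows "measure \<mu> {x. \<forall>i\<ge>I. columns_agree F m p i x} \<le> measure L {x. \<forall>i. columns_agree F m p i x}"
    (is "measure \<mu> ?Q \<le> measure L ?P")
proof -
  interpret \<mu>: prob_space \<mu> using \<mu> by (simp add: borel_prob_def)
  interpret L: prob_space L using L by (simp add: borel_prob_def)
  have sets: "sets \<mu> = sets borel" "sets L = sets borel" using \<mu> L by (auto simp: borel_prob_def)
  have sp: "space \<mu> = UNIV" using sets_eq_imp_space_eq[OF sets(1)] by simp
  \<comment> \<open>Pure periodicity is only a closed condition. Testing finitely many times gives
    clopen sets, to which vague convergence applies, and \<open>k\<close> tends to infinity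
    afterwards.\<close>
  define E where "E k = {x. \<forall>i<k. columns_agree F m p i x}" for k
  have E_eq: "E k = (\<Inter>i\<in>{..<k}. {x. columns_agree F m p i x})" for k by (auto simp: E_def)
  have E: "open (E k)" "closed (E k)" for k
    unfolding E_eq by (intro open_INT closed_INT ballI clopen_columns_agree CA finite_lessThan)+
  have "measure \<mu> ?Q \<le> measure L (E k)" for k
  proof (rule cesaro_lower_bound)
    show "(\<lambda>n. (\<Sum>i<n. measure \<mu> ((F ^^ i) -` E k)) / real n) \<longlonglongrightarrow> measure L (E k)"
      using vague_limit_clopen[OF lim sets_cesaro_measure sets(2) E, of k] E(1)[of k]
      by (simp add: measure_cesaro_measure[OF \<mu> CA])
    fix i assume "i \<ge> I"
    then have "?Q \<subseteq> (F ^^ i) -` E k"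
      by (auto simp: E_def columns_agree_funpow)
    moreover have "(F ^^ i) -` E k \<in> \<mu>.events"
      using measurable_sets[OF CA_funpow_measurable[OF CA sets(1)], of "E k" i] E(1)[of k]
      by (simp add: sp)
    ultimately show "measure \<mu> ?Q \<le> measure \<mu> ((F ^^ i) -` E k)"
      by (rule \<mu>.finite_measure_mono)
  qed auto
  moreover have "(\<lambda>k. measure L (E k)) \<longlonglongrightarrow> measure L (\<Inter>k. E k)"
  proof (rule L.finite_Lim_measure_decseq)
    show "range E \<subseteq> L.events" using E by (auto simp: sets)
    show "decseq E" by (auto simp: decseq_def E_def)
  qed
  ultimately have "measure \<mu> ?Q \<le> measure L (\<Inter>k. E k)" using LIMSEQ_le_const by blast
  also have "(\<Inter>k. E k) = ?P" by (auto simp: E_def)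
  finally show ?thesis .
qed

text \<open>The sets \<open>Q N\<close> increase to full \<open>\<mu>\<close>-measure, and each has
  at most the \<open>L\<close>-measure of the purely periodic columns, which is therefore 1.\<close>

lemma AE_vague_limit_periodic_columns:
  fixes \<mu> :: "'a::{finite, discrete_topology} config measure"
  assumes \<mu>: "borel_prob \<mu>" and CA: "cellular_automaton F"
    and AE: "AE x in \<mu>. eventually_periodic_column F m x"
    and L: "borel_prob L" and lim: "vague_limit (cesaro_measure \<mu> F) L"
  shows "AE x in L. \<exists>p>0. \<forall>i. columns_agree F m p i x"
proof -
  interpret \<mu>: prob_space \<mu> using \<mu> by (simp add: borel_prob_def)
  interpret L: prob_space L using L by (simp add: borel_prob_def)
  have sets: "sets \<mu> = sets borel" "sets L = sets borel" using \<mu> L by (auto simp: borel_prob_def)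
  text \<open>The period \<open>fact N\<close> makes the family increasing and absorbs every period eventually.\<close>
  define Q where "Q N = {x. \<forall>i\<ge>N. columns_agree F m (fact N) i x}" for N
  define P where "P p = {x. \<forall>i. columns_agree F m p i x}" for p
  have Q_eq: "Q N = (\<Inter>i\<in>{N..}. {x. columns_agree F m (fact N) i x})" for N
    by (auto simp: Q_def)
  have P_eq: "P p = (\<Inter>i. {x. columns_agree F m p i x})" for p
    by (auto simp: P_def)
  have "closed (Q N)" "closed (P p)" for N p
    unfolding Q_eq P_eq by (intro closed_INT ballI clopen_columns_agree CA)+
  then have Q_sets: "Q N \<in> \<mu>.events" and P_sets: "P p \<in> L.events" for N p
    by (auto simp: sets)
  have R_sets: "(\<Union>p\<in>{0<..}. P p) \<in> L.events" using P_sets by blast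
  have Q_mono: "incseq Q"
  proof (rule incseq_SucI, rule subsetI)
    fix N x assume "x \<in> Q N"
    then show "x \<in> Q (Suc N)"
      using columns_agree_mult[of N F m "fact N" x _ "Suc N"] by (auto simp: Q_def)
  qed
  have "AE x in \<mu>. x \<in> (\<Union>N. Q N)"
    using AE
  proof eventually_elim
    case (elim x)
    then obtain p N where p: "p > 0" and N: "\<And>i. i \<ge> N \<Longrightarrow> columns_agree F m p i x"
      by (auto simp: eventually_periodic_column_def)
    \<comment> \<open>Taking the maximum with \<open>p\<close> ensures that \<open>p\<close> divides
      the factorial, while times beyond it are still beyond \<open>N\<close>.\<close>
    obtain q where q: "fact (max p N) = q * p"
      using dvd_fact[of p "max p N"] p by (auto simp: dvd_def mult.commute)
    have "x \<in> Q (max p N)"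
      unfolding Q_def q using columns_agree_mult[OF N] by auto
    then show ?case by blast
  qed
  then have "measure \<mu> (\<Union>N. Q N) = 1"
    using Q_sets by (subst \<mu>.prob_eq_1) auto
  moreover have "(\<lambda>N. measure \<mu> (Q N)) \<longlonglongrightarrow> measure \<mu> (\<Union>N. Q N)"
    using Q_sets Q_mono by (intro \<mu>.finite_Lim_measure_incseq) auto
  ultimately have "(\<lambda>N. measure \<mu> (Q N)) \<longlonglongrightarrow> 1" by simp
  moreover have "measure \<mu> (Q N) \<le> measure L (\<Union>p\<in>{0<..}. P p)" for N
  proof -
    have "measure \<mu> (Q N) \<le> measure L (P (fact N))"
      unfolding Q_def P_def by (rule vague_limit_periodic_columns[OF \<mu> CA L lim])
    also have "\<dots> \<le> measure L (\<Union>p\<in>{0<..}. P p)"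
      using R_sets by (intro L.finite_measure_mono UN_upper) auto
    finally show ?thesis .
  qed
  ultimately have "1 \<le> measure L (\<Union>p\<in>{0<..}. P p)"
    using LIMSEQ_le_const2 by blast
  then have "measure L (\<Union>p\<in>{0<..}. P p) = 1"
    using L.prob_le_1 by (simp add: antisym)
  then have "AE x in L. x \<in> (\<Union>p\<in>{0<..}. P p)" using R_sets by (simp add: L.prob_eq_1)
  then show ?thesis by (auto simp: P_def)
qed

text \<open>The null set in the density theorem depends on the class. Almost every point lies in one
  of countably many classes, finitely many for each period, so these null sets can be
  united.\<close>

lemma AE_orbit_cyl_density:
  fixes \<nu> :: "'a::{finite, discrete_topology} config measure"
  assumes \<nu>: "borel_prob \<nu>" and CA: "cellular_automaton F"
    and per: "AE x in \<nu>. \<exists>p>0. \<forall>i. columns_agree F m p i x"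
  shows "AE x in \<nu>. (\<forall>n. measure \<nu> (cyl n x) > 0) \<longrightarrow>
    (\<lambda>n. measure \<nu> (cyl n x \<inter> orbit_cyl F m x) / measure \<nu> (cyl n x)) \<longlonglongrightarrow> 1"
proof -
  define \<C> where "\<C> = (\<Union>p\<in>{0<..}. orbit_cyl F m ` {x. \<forall>i. columns_agree F m p i x})"
  have "countable \<C>"
    unfolding \<C>_def
    by (rule countable_UN) (auto intro: countable_finite finite_periodic_orbit_cyls)
  moreover have "AE x in \<nu>. x \<in> B \<longrightarrow> (\<forall>n. measure \<nu> (cyl n x) > 0) \<longrightarrow>
    (\<lambda>n. measure \<nu> (cyl n x \<inter> B) / measure \<nu> (cyl n x)) \<longlonglongrightarrow> 1" if B: "B \<in> \<C>" for B
  proof -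
    obtain y where y: "B = orbit_cyl F m y" using B by (auto simp: \<C>_def)
    \<comment> \<open>Agreement with \<open>y\<close> is required at the first \<open>k\<close>
      times only, which leaves finitely many clopen conditions.\<close>
    define E where "E k = (\<Inter>i\<in>{..<k}. {x. (F ^^ i) x \<in> cyl m ((F ^^ i) y)})" for k :: nat
    have "open (E k)" for k
      unfolding E_def by (intro open_INT finite_lessThan ballI clopen_mem_cyl CA_funpow_continuous CA continuous_on_const)
    moreover have "decseq E" by (auto simp: decseq_def E_def)
    moreover have "B = (\<Inter>k. E k)" by (auto simp: y E_def orbit_cyl_eq)
    ultimately show ?thesis using AE_cyl_density[OF \<nu>, of E] by simp
  qed
  ultimately have "AE x in \<nu>. \<forall>B\<in>\<C>. x \<in> B \<longrightarrow> (\<forall>n. measure \<nu> (cyl n x) > 0) \<longrightarrow>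
    (\<lambda>n. measure \<nu> (cyl n x \<inter> B) / measure \<nu> (cyl n x)) \<longlonglongrightarrow> 1"
    by (simp add: AE_ball_countable)
  then show ?thesis using per
  proof eventually_elim
    case (elim x)
    then have "orbit_cyl F m x \<in> \<C>" by (auto simp: \<C>_def)
    moreover have "x \<in> orbit_cyl F m x" by (simp add: orbit_cyl_eq)
    ultimately show ?case using elim(1) by blast
  qed
qed

theorem theorem2p2:
  fixes \<mu> :: "'a::{finite, discrete_topology} config measure"
    and F :: "'a config \<Rightarrow> 'a config"
  assumes "borel_prob \<mu>"
    and "shift_ergodic \<mu>"
    and "equicontinuous_CA \<mu> F"
  shows "(\<exists>\<mu>c. borel_prob \<mu>c \<and> vague_limit (cesaro_measure \<mu> F) \<mu>c) \<and>
         (\<forall>\<mu>c. borel_prob \<mu>c \<and> vague_limit (cesaro_measure \<mu> F) \<mu>c \<longrightarrow> equicontinuous_CA \<mu>c F)"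
proof (intro conjI allI impI)
  have CA: "cellular_automaton F" using assms(3) by (simp add: equicontinuous_CA_def)
  have AE: "AE x in \<mu>. \<forall>m. eventually_periodic_column F m x"
    using assms by (intro AE_eventually_periodic_columns) (auto simp: shift_ergodic_def)
  show "\<exists>\<mu>c. borel_prob \<mu>c \<and> vague_limit (cesaro_measure \<mu> F) \<mu>c"
    using assms(1) CA AE by (rule cesaro_vague_limit_exists)
  fix L assume "borel_prob L \<and> vague_limit (cesaro_measure \<mu> F) L"
  then have L: "borel_prob L" and lim: "vague_limit (cesaro_measure \<mu> F) L" by auto
  have "AE x in L. \<exists>p>0. \<forall>i. columns_agree F m p i x" for m
    using AE_vague_limit_periodic_columns[OF assms(1) CA _ L lim] AE by (simp add: AE_all_countable)
  \<comment> \<open>The exceptional sets for the countably many \<open>m\<close> are united into one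
    null set.\<close>
  then have "AE x in L. \<forall>m. (\<forall>n. measure L (cyl n x) > 0) \<longrightarrow>
    (\<lambda>n. measure L (cyl n x \<inter> orbit_cyl F m x) / measure L (cyl n x)) \<longlonglongrightarrow> 1"
    unfolding AE_all_countable by (intro allI AE_orbit_cyl_density[OF L CA])
  then have "AE x in L. equicontinuous_point L F x"
    using AE_cyl_positive[OF L] by eventually_elim (simp add: equicontinuous_point_def)
  then show "equicontinuous_CA L F" using CA by (simp add: equicontinuous_CA_def)
qed

end
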